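(* Let $n\ge1$, let $v_1,\dots,v_n\in\mathbb{R}\setminus\{0\}$, let $B_1,\dots,B_n$ be independent Bernoulli random variables with variances $\sigma_1^2,\dots,\sigma_n^2$, and set $S_v=v_1B_1+\cdots+v_nB_n$ and $\sigma^2=\sum_{i=1}^n\sigma_i^2$, with $\sigma^2>0$. Then for every $\alpha\in[2,\infty]$, $$H_\alpha(S_v)\ \geq\ \log\left[\frac{\sqrt{6\sigma^2\alpha'}}{\int_0^{\sqrt{6\sigma^2\alpha'}}e^{-t^2/2}\,dt}\right]\ \geq\ \frac12\max\left\{\log(1+2\alpha'\sigma^2),\ \log\left(\frac{12\,\alpha'\sigma^2}{\pi}\right)\right\}.$$
   Context: A Bernoulli random variable $B$ takes values in $\{0,1\}$ with $\mathbb{P}(B=1)=p=1-\mathbb{P}(B=0)$ for some $p\in[0,1]$ (the parameters of the $B_i$ may differ). For a discrete random variable $S$ with $f_S(x)=\mathbb{P}(S=x)$, the $\alpha$-Rényi entropy is $H_\alpha(S)=(1-\alpha)^{-1}\log\sum_{x}f_S(x)^\alpha$ for $\alpha\in(1,\infty)$ and $H_\infty(S)=-\log\sup_x f_S(x)$, with $\log$ the natural logarithm. The conjugate exponent is $\alpha'=\alpha/(\alpha-1)$, with $\alpha'=1$ when $\alpha=\infty$. *)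

theory Defs
  imports "HOL-Probability.Probability"
begin

definition bernoulli_rv :: "'a measure \<Rightarrow> ('a \<Rightarrow> real) \<Rightarrow> real \<Rightarrow> bool" where
  "bernoulli_rv M X p \<longleftrightarrow>
     X \<in> borel_measurable M \<and> (AE \<omega> in M. X \<omega> \<in> {0, 1}) \<and> p \<in> {0..1} \<and>
     measure M {\<omega> \<in> space M. X \<omega> = 1} = p \<and> measure M {\<omega> \<in> space M. X \<omega> = 0} = 1 - p"

definition point_mass :: "'a measure \<Rightarrow> ('a \<Rightarrow> 'b) \<Rightarrow> 'b \<Rightarrow> real" where
  "point_mass M S x = measure M {\<omega> \<in> space M. S \<omega> = x}"

text \<open>
  Meant for \<open>1 < \<alpha> \<le> \<infinity>\<close> and discrete \<open>S\<close>. There the sum runs over all values of the type, since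
  \<open>0 powr \<alpha> = 0\<close>; it converges because the point masses sum to at most 1.
\<close>
definition renyi_entropy :: "ereal \<Rightarrow> 'a measure \<Rightarrow> ('a \<Rightarrow> 'b) \<Rightarrow> real" where
  "renyi_entropy \<alpha> M S =
     (if \<alpha> = \<infinity> then - ln (SUP x. point_mass M S x)
      else inverse (1 - real_of_ereal \<alpha>) * ln (\<Sum>\<^sub>\<infinity>x. point_mass M S x powr real_of_ereal \<alpha>))"

definition conjugate_exponent :: "ereal \<Rightarrow> real" where
  "conjugate_exponent \<alpha> =
     (if \<alpha> = \<infinity> then 1 else real_of_ereal \<alpha> / (real_of_ereal \<alpha> - 1))"

end

theory Submission
  imports Defs "HOL-Complex_Analysis.Conformal_Mappings" "HOL-Number_Theory.Cong"
begin

text \<open>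
  Dirichlet's simultaneous approximation replaces \<open>v\<close> by nonzero integers \<open>w\<close> such that
  \<open>\<Sum>i\<in>J. w i\<close> is a function of \<open>\<Sum>i\<in>J. v i\<close>. For a prime \<open>N > \<bar>w i\<bar>\<close>, reducing
  \<open>\<Sum>i. w i * B i\<close> modulo \<open>N\<close> can only decrease the entropy, and the Hausdorff--Young inequality
  on \<open>Z/N\<close> bounds the entropy of the residue from below by \<open>- ln A\<close>, where \<open>A\<close> is the mean over
  the characters of \<open>\<bar>\<phi>\<bar> powr \<alpha>'\<close>, with \<open>\<phi>\<close> the characteristic function.
  Since \<open>\<phi>\<close> is a product with factors of modulus at most
  \<open>exp (- p i * (1 - p i) * (1 - cos t))\<close>, Jensen's inequality yields
  \<open>A \<le>\<close> the mean over \<open>k < N\<close> of \<open>exp (- \<alpha>' * \<sigma>\<^sup>2 * (1 - cos (2 * pi * k / N)))\<close>, a Riemann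
  sum. As \<open>N \<rightarrow> \<infinity>\<close> its limit is compared with the Gaussian integral, \<open>1 - cos (pi * u)\<close> being
  dominated by \<open>3 * u\<^sup>2\<close> in convex order on \<open>[0, 1]\<close>.
\<close>

section \<open>The Hausdorff--Young inequality on cyclic groups\<close>

text \<open>A normalised three lines theorem. Dividing \<open>f\<close> by
  \<open>1 + e (z - a)\<close>, which has modulus at least 1 on the strip and grows vertically, lets
  the maximum modulus principle apply on a tall rectangle; then \<open>e\<close> tends to 0.\<close>

lemma norm_le_one_on_strip:
  fixes f :: "complex \<Rightarrow> complex"
  assumes holo: "f holomorphic_on UNIV"
    and bdd: "\<And>z. a \<le> Re z \<Longrightarrow> Re z \<le> b \<Longrightarrow> norm (f z) \<le> C"
    and edge: "\<And>z. Re z = a \<or> Re z = b \<Longrightarrow> norm (f z) \<le> 1"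
    and z: "a \<le> Re z" "Re z \<le> b"
  shows "norm (f z) \<le> 1"
proof -
  have damped: "norm (f z) \<le> norm (1 + of_real e * (z - of_real a))" if e: "e > 0" for e :: real
  proof -
    \<comment> \<open>The rectangle contains \<open>z\<close>, and on its horizontal sides the
      divisor has modulus at least \<open>e * T\<close>, which exceeds the crude bound
      \<open>C\<close>.\<close>
    define T where "T = max \<bar>Im z\<bar> (C / e) + 1"
    define S where "S = cbox (Complex a (- T)) (Complex b T)"
    define d where "d w = 1 + of_real e * (w - of_real a)" for w :: complex
    have T: "\<bar>Im z\<bar> < T" "C / e < T" by (auto simp: T_def)
    have mem_S: "w \<in> S \<longleftrightarrow> a \<le> Re w \<and> Re w \<le> b \<and> - T \<le> Im w \<and> Im w \<le> T" for w
      by (auto simp: S_def in_cbox_complex_iff)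
    have d1: "norm (d w) \<ge> 1" if "a \<le> Re w" for w
    proof -
      have "1 \<le> Re (d w)" using that e by (simp add: d_def)
      also have "\<dots> \<le> norm (d w)" by (rule complex_Re_le_cmod)
      finally show ?thesis .
    qed
    have d0: "d w \<noteq> 0" if "w \<in> S" for w
      using d1[of w] that by (auto simp: mem_S)
    have hol: "(\<lambda>w. f w / d w) holomorphic_on S"
      using d0 unfolding d_def
      by (intro holomorphic_intros holomorphic_on_subset[OF holo]) auto
    have clS: "closure S = S" by (simp add: S_def)
    have "norm (f z / d z) \<le> 1"
    proof (rule maximum_modulus_frontier[where f = "\<lambda>w. f w / d w" and S = S])
      show "(\<lambda>w. f w / d w) holomorphic_on interior S"
        using hol interior_subset by (rule holomorphic_on_subset)
      show "continuous_on (closure S) (\<lambda>w. f w / d w)"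
        unfolding clS using hol by (rule holomorphic_on_imp_continuous_on)
      show "bounded S" by (simp add: S_def)
      show "z \<in> S" using z T by (auto simp: mem_S)
      fix w assume "w \<in> frontier S"
      then have w: "w \<in> S" and "w \<notin> box (Complex a (- T)) (Complex b T)"
        by (auto simp: frontier_def clS S_def interior_cbox)
      then consider "Re w = a \<or> Re w = b" | "\<bar>Im w\<bar> = T"
        by (fastforce simp: mem_S in_box_complex_iff)
      then show "norm (f w / d w) \<le> 1"
      proof cases
        case 1
        then show ?thesis using edge[of w] d1[of w] w
          by (auto simp: mem_S norm_divide divide_le_eq)
      next
        case 2
        have "C \<le> e * T" using T(2) e by (simp add: field_simps)
        also have "\<dots> = \<bar>Im (d w)\<bar>" using e 2 by (simp add: d_def abs_mult)
        also have "\<dots> \<le> norm (d w)" by (rule abs_Im_le_cmod)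
        finally have "norm (f w) \<le> norm (d w)"
          using bdd[of w] w by (auto simp: mem_S)
        then show ?thesis using d1[of w] w by (auto simp: mem_S norm_divide divide_le_eq)
      qed
    qed
    moreover have "norm (d z) > 0" using d1[OF z(1)] by linarith
    ultimately show ?thesis by (simp add: norm_divide divide_le_eq d_def split: if_splits)
  qed
  have "((\<lambda>e. norm (1 + of_real e * (z - of_real a))) \<longlongrightarrow> norm (1 + of_real 0 * (z - of_real a))) (at_right 0)"
    by (intro tendsto_intros)
  moreover have "eventually (\<lambda>e. norm (f z) \<le> norm (1 + of_real e * (z - of_real a))) (at_right (0::real))"
    using damped by (auto simp: eventually_at_right_less intro: eventually_mono[OF eventually_at_right_less])
  ultimately show ?thesis
    using tendsto_lowerbound[of _ _ "at_right (0::real)" "norm (f z)"] by fastforce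
qed

section \<open>Characters of the cyclic group \<open>Z/N\<close> and its Fourier transform\<close>

lemma sum_affine_mod:
  fixes N c d :: int
  assumes "N > 0" "coprime c N"
  shows "(\<Sum>k\<in>{0..<N}. g ((c * k + d) mod N)) = (\<Sum>k\<in>{0..<N}. g k)"
proof -
  have "inj_on (\<lambda>k. (c * k + d) mod N) {0..<N}"
  proof (rule inj_onI)
    fix x y assume xy: "x \<in> {0..<N}" "y \<in> {0..<N}" and "(c * x + d) mod N = (c * y + d) mod N"
    then have "[c * x = c * y] (mod N)" by (simp add: cong_def[symmetric] cong_add_rcancel)
    then have "[x = y] (mod N)" using assms by (simp add: cong_mult_lcancel)
    then show "x = y" using xy by (simp add: cong_def)
  qed
  moreover have "(\<lambda>k. (c * k + d) mod N) ` {0..<N} \<subseteq> {0..<N}" using assms by auto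
  ultimately have "bij_betw (\<lambda>k. (c * k + d) mod N) {0..<N} {0..<N}"
    by (simp add: bij_betw_def endo_inj_surj)
  then show ?thesis by (rule sum.reindex_bij_betw)
qed

definition zn_char :: "int \<Rightarrow> int \<Rightarrow> complex" where
  "zn_char N m = cis (2 * pi * of_int m / of_int N)"

lemma norm_zn_char [simp]: "norm (zn_char N m) = 1"
  by (simp add: zn_char_def)

lemma zn_char_add: "zn_char N (m + l) = zn_char N m * zn_char N l"
  by (simp add: zn_char_def cis_mult add_divide_distrib distrib_left)

lemma zn_char_0 [simp]: "zn_char N 0 = 1"
  by (simp add: zn_char_def)

lemma zn_char_sum: "zn_char N (\<Sum>i\<in>I. m i) = (\<Prod>i\<in>I. zn_char N (m i))"
  by (induction I rule: infinite_finite_induct) (simp_all add: zn_char_add)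

lemma zn_char_minus: "zn_char N (- m) = cnj (zn_char N m)"
  by (simp add: zn_char_def cis_cnj)

lemma zn_char_eq_1_iff:
  assumes "N > 0"
  shows "zn_char N m = 1 \<longleftrightarrow> N dvd m"
proof -
  have "zn_char N m = 1 \<longleftrightarrow> (\<exists>j::int. 2 * pi * of_int m / of_int N = 2 * pi * of_int j)"
    unfolding zn_char_def cis_conv_exp exp_eq_1 by (simp add: mult_ac)
  also have "\<dots> \<longleftrightarrow> (\<exists>j. m = N * j)"
  proof -
    have "2 * pi * of_int m / of_int N = 2 * pi * of_int j \<longleftrightarrow> m = N * j" for j
      using assms by (simp add: field_simps flip: of_int_mult)
    then show ?thesis by simp
  qed
  finally show ?thesis by (simp add: dvd_def)
qed

lemma zn_char_cong:
  assumes "N > 0" "[m = l] (mod N)"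
  shows "zn_char N m = zn_char N l"
proof -
  have "zn_char N (m - l) = 1"
    using assms by (simp add: zn_char_eq_1_iff cong_iff_dvd_diff)
  then show ?thesis using zn_char_add[of N "m - l" l] by simp
qed

text \<open>Shifting \<open>k\<close> by one permutes the residues and multiplies the sum by
  \<open>zn_char N m\<close>. Unless this factor is 1, the sum vanishes.\<close>

lemma sum_zn_char:
  assumes "N > 0"
  shows "(\<Sum>k\<in>{0..<N}. zn_char N (k * m)) = (if N dvd m then of_int N else 0)"
proof (cases "N dvd m")
  case True
  then have "zn_char N (k * m) = 1" for k
    using assms by (simp add: zn_char_eq_1_iff)
  then show ?thesis using True assms by simp
next
  case False
  let ?S = "\<Sum>k\<in>{0..<N}. zn_char N (k * m)"
  have "?S = (\<Sum>k\<in>{0..<N}. zn_char N ((1 * k + 1) mod N * m))"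
    by (rule sum_affine_mod[symmetric]) (use assms in auto)
  also have "\<dots> = (\<Sum>k\<in>{0..<N}. zn_char N m * zn_char N (k * m))"
  proof (rule sum.cong[OF refl])
    fix k
    have "zn_char N ((1 * k + 1) mod N * m) = zn_char N ((k + 1) * m)"
      by (rule zn_char_cong[OF assms]) (simp add: cong_def mod_mult_left_eq)
    then show "zn_char N ((1 * k + 1) mod N * m) = zn_char N m * zn_char N (k * m)"
      by (simp add: distrib_right zn_char_add)
  qed
  finally have "(1 - zn_char N m) * ?S = 0"
    by (simp add: sum_distrib_left[symmetric] left_diff_distrib)
  then show ?thesis using False assms by (simp add: zn_char_eq_1_iff)
qed

lemma zn_fourier_inversion:
  assumes N: "N > 0" and y: "y \<in> {0..<N}"
  shows "(\<Sum>k\<in>{0..<N}. (\<Sum>x\<in>{0..<N}. f x * zn_char N (k * x)) * zn_char N (- (k * y))) = of_int N * f y"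
proof -
  have "(\<Sum>k\<in>{0..<N}. (\<Sum>x\<in>{0..<N}. f x * zn_char N (k * x)) * zn_char N (- (k * y)))
     = (\<Sum>k\<in>{0..<N}. \<Sum>x\<in>{0..<N}. f x * zn_char N (k * (x - y)))"
    by (simp add: sum_distrib_right mult.assoc zn_char_add[symmetric] right_diff_distrib)
  also have "\<dots> = (\<Sum>x\<in>{0..<N}. f x * (\<Sum>k\<in>{0..<N}. zn_char N (k * (x - y))))"
    by (subst sum.swap) (simp add: sum_distrib_left)
  also have "\<dots> = (\<Sum>x\<in>{0..<N}. if x = y then of_int N * f y else 0)"
  proof (rule sum.cong[OF refl])
    fix x assume "x \<in> {0..<N}"
    then have "N dvd x - y \<longleftrightarrow> x = y"
      using y by (auto simp: mod_eq_dvd_iff[symmetric])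
    then show "f x * (\<Sum>k\<in>{0..<N}. zn_char N (k * (x - y))) = (if x = y then of_int N * f y else 0)"
      using N by (simp add: sum_zn_char)
  qed
  finally show ?thesis using y by simp
qed

text \<open>Expanding only the conjugated factor of each squared modulus and swapping the sums
  leaves an inner sum that Fourier inversion evaluates.\<close>

lemma zn_parseval:
  assumes N: "N > 0"
  shows "(\<Sum>k\<in>{0..<N}. (norm (\<Sum>x\<in>{0..<N}. b x * zn_char N (k * x)))\<^sup>2) = of_int N * (\<Sum>x\<in>{0..<N}. (norm (b x))\<^sup>2)"
proof -
  define G where "G k = (\<Sum>x\<in>{0..<N}. b x * zn_char N (k * x))" for k
  have "complex_of_real (\<Sum>k\<in>{0..<N}. (norm (G k))\<^sup>2) = (\<Sum>k\<in>{0..<N}. G k * cnj (G k))"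
    by (simp only: complex_norm_square of_real_sum)
  also have "\<dots> = (\<Sum>k\<in>{0..<N}. \<Sum>y\<in>{0..<N}. cnj (b y) * (G k * zn_char N (- (k * y))))"
    by (subst (2) G_def) (simp add: sum_distrib_left mult_ac zn_char_minus)
  also have "\<dots> = (\<Sum>y\<in>{0..<N}. cnj (b y) * (\<Sum>k\<in>{0..<N}. G k * zn_char N (- (k * y))))"
    by (subst sum.swap) (simp add: sum_distrib_left)
  also have "\<dots> = (\<Sum>y\<in>{0..<N}. cnj (b y) * (of_int N * b y))"
    by (rule sum.cong[OF refl]) (simp only: G_def zn_fourier_inversion[OF N])
  also have "\<dots> = complex_of_real (of_int N * (\<Sum>x\<in>{0..<N}. (norm (b x))\<^sup>2))"
    by (simp add: sum_distrib_left mult_ac flip: complex_norm_square)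
  finally show ?thesis by (simp only: of_real_eq_iff G_def)
qed

text \<open>The bound does not depend on the exponent, so it supplies the crude bound over the whole
  strip required by \<open>norm_le_one_on_strip\<close>.\<close>

lemma powr_le_one_plus:
  fixes x s :: real
  assumes "0 \<le> x" "0 \<le> s" "s \<le> 1"
  shows "x powr s \<le> 1 + x"
proof (cases "x \<le> 1")
  case True
  then show ?thesis using powr_le1[of s x] assms by simp
next
  case False
  then have "x powr s \<le> x powr 1" using assms by (intro powr_mono) auto
  then show ?thesis using False by simp
qed

text \<open>
  The exponent \<open>s\<close> interpolates between the trivial bound (\<open>s = 1\<close>) and Cauchy--Schwarz with
  Parseval (\<open>s = 1/2\<close>) by the maximum principle on the strip \<open>1/2 \<le> Re z \<le> 1\<close>.
\<close>
lemma zn_char_powr_form_le: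
  fixes K h :: "int \<Rightarrow> real"
  assumes N: "N > 0"
    and K: "\<And>k. 0 \<le> K k" "(\<Sum>k\<in>{0..<N}. K k) = of_int N"
    and h: "\<And>x. 0 \<le> h x" "(\<Sum>x\<in>{0..<N}. h x) = 1"
    and u: "\<And>k. norm (u k) \<le> 1"
    and s: "1 / 2 \<le> s" "s \<le> 1"
  shows "norm (\<Sum>k\<in>{0..<N}. \<Sum>x\<in>{0..<N}. u k * of_real (K k powr s) * (of_real (h x powr s) * zn_char N (k * x))) \<le> of_int N"
proof -
  define \<Phi> where "\<Phi> z = (\<Sum>k\<in>{0..<N}. \<Sum>x\<in>{0..<N}.
    u k * of_real (K k) powr z * (of_real (h x) powr z * zn_char N (k * x)))" for z :: complex
  have nK: "norm (of_real (K k) powr z) = K k powr Re z" for k z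
    using K by (simp add: norm_powr_real_powr)
  have nh: "norm (of_real (h x) powr z) = h x powr Re z" for x z
    using h by (simp add: norm_powr_real_powr)
  have crude: "norm (\<Phi> z) \<le> (\<Sum>k\<in>{0..<N}. \<Sum>x\<in>{0..<N}. K k powr Re z * h x powr Re z)" for z
    unfolding \<Phi>_def
  proof (intro order_trans[OF norm_sum] sum_mono)
    fix k x
    have "norm (u k) * (K k powr Re z * h x powr Re z) \<le> 1 * (K k powr Re z * h x powr Re z)"
      by (intro mult_right_mono u) auto
    then show "norm (u k * of_real (K k) powr z * (of_real (h x) powr z * zn_char N (k * x))) \<le> K k powr Re z * h x powr Re z"
      by (simp add: norm_mult nK nh mult_ac)
  qed
  have "norm (\<Phi> (of_real s) / of_int N) \<le> 1"
  proof (rule norm_le_one_on_strip[where f = "\<lambda>z. \<Phi> z / of_int N" and a = "1 / 2" and b = 1 and C = "(\<Sum>k\<in>{0..<N}. \<Sum>x\<in>{0..<N}. (1 + K k) * (1 + h x)) / of_int N"])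
    show "(\<lambda>z. \<Phi> z / of_int N) holomorphic_on UNIV"
    proof -
      \<comment> \<open>The exponent varies while the base is fixed, so the power is entire; for
        base 0 it is constantly 0 by the convention \<open>0 powr z = 0\<close>.\<close>
      have "(\<lambda>z. complex_of_real c powr z) holomorphic_on UNIV" for c
        by (cases "c = 0") (auto intro!: holomorphic_intros)
      then show ?thesis unfolding \<Phi>_def using N by (intro holomorphic_intros) auto
    qed
  next
    fix z :: complex assume z: "1 / 2 \<le> Re z" "Re z \<le> 1"
    note crude
    also have "(\<Sum>k\<in>{0..<N}. \<Sum>x\<in>{0..<N}. K k powr Re z * h x powr Re z)
        \<le> (\<Sum>k\<in>{0..<N}. \<Sum>x\<in>{0..<N}. (1 + K k) * (1 + h x))"
      using z K h by (intro sum_mono mult_mono powr_le_one_plus) auto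
    finally show "norm (\<Phi> z / of_int N) \<le> (\<Sum>k\<in>{0..<N}. \<Sum>x\<in>{0..<N}. (1 + K k) * (1 + h x)) / of_int N"
      using N by (simp add: norm_divide divide_right_mono)
  next
    fix z :: complex assume "Re z = 1 / 2 \<or> Re z = 1"
    then show "norm (\<Phi> z / of_int N) \<le> 1"
    proof
      assume z: "Re z = 1"
      have "norm (\<Phi> z) \<le> (\<Sum>k\<in>{0..<N}. \<Sum>x\<in>{0..<N}. K k * h x)"
        using crude[of z] K h z by simp
      also have "\<dots> = of_int N" using K h by (simp flip: sum_product)
      finally show ?thesis using N by (simp add: norm_divide divide_le_eq)
    next
      assume z: "Re z = 1 / 2"
      define G where "G k = (\<Sum>x\<in>{0..<N}. of_real (h x) powr z * zn_char N (k * x))" for k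
      have "(norm (\<Phi> z))\<^sup>2 \<le> (\<Sum>k\<in>{0..<N}. norm (u k * of_real (K k) powr z) * norm (G k))\<^sup>2"
        unfolding \<Phi>_def G_def
        by (intro power_mono order_trans[OF norm_sum]) (simp_all add: norm_mult flip: sum_distrib_left)
      also have "\<dots> \<le> (\<Sum>k\<in>{0..<N}. (norm (u k * of_real (K k) powr z))\<^sup>2) * (\<Sum>k\<in>{0..<N}. (norm (G k))\<^sup>2)"
        by (rule Cauchy_Schwarz_ineq_sum)
      also have "\<dots> \<le> (\<Sum>k\<in>{0..<N}. K k) * (of_int N * (\<Sum>x\<in>{0..<N}. h x))"
      proof (intro mult_mono sum_mono)
        fix k
        have "norm (u k * of_real (K k) powr z) \<le> 1 * sqrt (K k)"
          unfolding norm_mult nK z using K u by (intro mult_mono) (auto simp: powr_half_sqrt)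
        then show "(norm (u k * of_real (K k) powr z))\<^sup>2 \<le> K k"
          using K power_mono[of "norm (u k * of_real (K k) powr z)" "sqrt (K k)" 2] by simp
        have "(\<Sum>k\<in>{0..<N}. (norm (G k))\<^sup>2) = of_int N * (\<Sum>x\<in>{0..<N}. (norm (of_real (h x) powr z))\<^sup>2)"
          unfolding G_def by (rule zn_parseval[OF N])
        also have "\<dots> = of_int N * (\<Sum>x\<in>{0..<N}. h x)"
          unfolding nh z using h by (simp add: powr_half_sqrt)
        finally show "(\<Sum>k\<in>{0..<N}. (norm (G k))\<^sup>2) \<le> of_int N * (\<Sum>x\<in>{0..<N}. h x)" by simp
      qed (use K N in \<open>auto intro: sum_nonneg\<close>)
      also have "\<dots> = (of_int N)\<^sup>2" using K h by (simp add: power2_eq_square)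
      finally have "norm (\<Phi> z) \<le> of_int N" using N by (simp add: power2_le_iff_abs_le)
      then show ?thesis using N by (simp add: norm_divide divide_le_eq)
    qed
  qed (use s in auto)
  moreover have "\<Phi> (of_real s) = (\<Sum>k\<in>{0..<N}. \<Sum>x\<in>{0..<N}. u k * of_real (K k powr s) * (of_real (h x powr s) * zn_char N (k * x)))"
    unfolding \<Phi>_def using K h by (simp add: powr_of_real)
  ultimately show ?thesis using N by (simp add: norm_divide divide_le_eq)
qed

definition zn_fourier :: "int \<Rightarrow> (int \<Rightarrow> real) \<Rightarrow> int \<Rightarrow> complex" where
  "zn_fourier N f k = (\<Sum>x\<in>{0..<N}. of_real (f x) * zn_char N (k * x))"

lemma zn_fourier_inversion_cnj:
  assumes "N > 0" "y \<in> {0..<N}"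
  shows "(\<Sum>k\<in>{0..<N}. cnj (zn_fourier N f k) * zn_char N (k * y)) = of_int N * of_real (f y)"
proof -
  have "cnj (\<Sum>k\<in>{0..<N}. zn_fourier N f k * zn_char N (- (k * y))) = cnj (of_int N * of_real (f y))"
    unfolding zn_fourier_def by (rule arg_cong[OF zn_fourier_inversion[OF assms]])
  then show ?thesis by (simp add: zn_char_minus)
qed

text \<open>The triangle inequality in the inversion formula. This is the endpoint of
  Hausdorff--Young that serves the case of infinite order.\<close>

lemma zn_le_mean_fourier:
  assumes "N > 0" "y \<in> {0..<N}"
  shows "f y \<le> (\<Sum>k\<in>{0..<N}. norm (zn_fourier N f k)) / of_int N"
proof -
  have "of_int N * f y \<le> norm (complex_of_int N * of_real (f y))"
    using assms by (simp add: norm_mult mult_left_mono)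
  also have "\<dots> \<le> (\<Sum>k\<in>{0..<N}. norm (zn_fourier N f k))"
    unfolding zn_fourier_inversion_cnj[OF assms, symmetric]
    by (rule order_trans[OF norm_sum]) (simp add: norm_mult)
  finally show ?thesis using assms by (simp add: le_divide_eq mult.commute)
qed

text \<open>Duality: \<open>zn_char_powr_form_le\<close> is used with \<open>s = 1 / a\<close>, with
  weights made from \<open>f\<close> and its transform, and with the conjugate phase of the
  transform as \<open>u\<close>. Inversion evaluates the form explicitly, giving
  \<open>B powr (1 - 1 / a)\<close> at most \<open>A powr (1 / a)\<close>.\<close>

lemma zn_hausdorff_young:
  fixes f :: "int \<Rightarrow> real" and a :: real
  assumes N: "N > 0" and f: "\<And>x. 0 \<le> f x" and a: "1 < a" "a \<le> 2"
  shows "(\<Sum>x\<in>{0..<N}. f x powr (a / (a - 1)))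
    \<le> ((\<Sum>k\<in>{0..<N}. norm (zn_fourier N f k) powr a) / of_int N) powr (1 / (a - 1))"
proof -
  define \<alpha> where "\<alpha> = a / (a - 1)"
  define A where "A = (\<Sum>k\<in>{0..<N}. norm (zn_fourier N f k) powr a) / of_int N"
  define B where "B = (\<Sum>x\<in>{0..<N}. f x powr \<alpha>)"
  have \<alpha>: "\<alpha> / a = \<alpha> - 1" "1 - 1 / a = 1 / \<alpha>" "\<alpha> / a = 1 / (a - 1)" "\<alpha> > 0"
    using a by (auto simp: \<alpha>_def field_simps)
  have "B \<ge> 0" "A \<ge> 0" using N by (auto simp: A_def B_def intro!: sum_nonneg divide_nonneg_nonneg)
  show ?thesis
  proof (cases "B = 0")
    case True
    then show ?thesis by (simp add: B_def \<alpha>_def)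
  next
    case False
    with \<open>B \<ge> 0\<close> have B: "B > 0" by simp
    \<comment> \<open>If \<open>A\<close> were 0, the whole transform would vanish, hence also
      \<open>f\<close> on the residues, against \<open>B > 0\<close>.\<close>
    have A: "A > 0"
    proof (rule ccontr)
      assume "\<not> A > 0"
      with \<open>A \<ge> 0\<close> have "A = 0" by simp
      then have "norm (zn_fourier N f k) powr a = 0" if "k \<in> {0..<N}" for k
        using that N by (simp add: A_def sum_nonneg_eq_0_iff)
      then have "f x \<le> 0" if "x \<in> {0..<N}" for x
        using zn_le_mean_fourier[OF N that, of f] by simp
      then have "f x = 0" if "x \<in> {0..<N}" for x using f[of x] that by (simp add: order_antisym)
      then show False using B by (simp add: B_def)
    qed
    \<comment> \<open>The divisors normalise the totals: \<open>K\<close> sums to \<open>N\<close>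
      because \<open>A\<close> is a mean, and \<open>h\<close> sums to 1.\<close>
    define K where "K k = norm (zn_fourier N f k) powr a / A" for k
    define h where "h x = f x powr \<alpha> / B" for x
    have Ks: "K k powr (1 / a) = norm (zn_fourier N f k) / A powr (1 / a)" for k
      using a A by (simp add: K_def powr_divide powr_powr)
    have hs: "h x powr (1 / a) = f x powr (\<alpha> - 1) / B powr (1 / a)" for x
      using a B f \<alpha> by (simp add: h_def powr_divide powr_powr)
    have "norm (\<Sum>k\<in>{0..<N}. \<Sum>x\<in>{0..<N}. cnj (sgn (zn_fourier N f k)) * of_real (K k powr (1 / a)) *
        (of_real (h x powr (1 / a)) * zn_char N (k * x))) \<le> of_int N"
      using a A B N
      by (intro zn_char_powr_form_le)
        (auto simp: K_def h_def norm_sgn field_simps B_def A_def sum_distrib_left simp flip: sum_divide_distrib)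
    \<comment> \<open>The conjugate phase times the modulus is the conjugate of the transform, so
      the inner sum over \<open>k\<close> becomes the one in
      \<open>zn_fourier_inversion_cnj\<close>.\<close>
    also have "(\<Sum>k\<in>{0..<N}. \<Sum>x\<in>{0..<N}. cnj (sgn (zn_fourier N f k)) * of_real (K k powr (1 / a)) *
        (of_real (h x powr (1 / a)) * zn_char N (k * x)))
      = (\<Sum>x\<in>{0..<N}. of_real (h x powr (1 / a)) / of_real (A powr (1 / a)) * (\<Sum>k\<in>{0..<N}. cnj (zn_fourier N f k) * zn_char N (k * x)))"
    proof -
      have "cnj (sgn w) * of_real (norm w) = cnj w" for w
        by (cases "w = 0") (auto simp: sgn_eq)
      then show ?thesis
        by (subst sum.swap) (simp add: Ks sum_distrib_left mult_ac)
    qed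
    also have "\<dots> = (\<Sum>x\<in>{0..<N}. of_real (of_int N * (f x * f x powr (\<alpha> - 1)) / (A powr (1 / a) * B powr (1 / a))))"
      by (rule sum.cong[OF refl]) (simp only: zn_fourier_inversion_cnj[OF N] hs, simp add: mult_ac)
    also have "\<dots> = of_real (of_int N * B / (A powr (1 / a) * B powr (1 / a)))"
    proof -
      have "f x * f x powr (\<alpha> - 1) = f x powr \<alpha>" for x
        using f[of x] by (cases "f x = 0") (simp_all add: powr_mult_base)
      then show ?thesis
        by (simp add: B_def flip: sum_divide_distrib sum_distrib_left)
    qed
    finally have "B \<le> A powr (1 / a) * B powr (1 / a)"
      using N A B by (simp add: norm_divide norm_mult divide_le_eq)
    then have "B powr (1 - 1 / a) \<le> A powr (1 / a)"
      using B by (simp add: powr_diff field_simps)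
    then have "(B powr (1 / \<alpha>)) powr \<alpha> \<le> (A powr (1 / a)) powr \<alpha>"
      using \<alpha> by (intro powr_mono2) auto
    then have "B \<le> A powr (1 / (a - 1))"
      using \<alpha> B by (simp add: powr_powr)
    then show ?thesis by (simp add: A_def B_def \<alpha>_def)
  qed
qed

section \<open>Riemann sums and Gaussian integrals\<close>

lemma riemann_sum_tendsto:
  fixes g :: "real \<Rightarrow> real"
  assumes "continuous_on {0..1} g"
  shows "(\<lambda>n. (\<Sum>k<n. g (real k / real n)) / real n) \<longlonglongrightarrow> integral {0..1} g"
proof (rule LIMSEQ_I)
  fix e :: real assume e: "e > 0"
  have "uniformly_continuous_on {0..1} g"
    using assms by (intro compact_uniformly_continuous) auto
  then obtain d where d: "d > 0" "\<And>x y. x \<in> {0..1} \<Longrightarrow> y \<in> {0..1} \<Longrightarrow> dist y x < d \<Longrightarrow> dist (g y) (g x) < e / 2"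
    using e unfolding uniformly_continuous_on_def by (meson half_gt_zero)
  obtain n0 :: nat where n0: "1 / d < real n0" using reals_Archimedean2 by blast
  have "norm ((\<Sum>k<n. g (real k / real n)) / real n - integral {0..1} g) < e" if n: "n \<ge> n0" for n
  proof -
    have "1 / d < real n" using n n0 by linarith
    moreover have "0 < 1 / d" using d by simp
    ultimately have n_pos: "0 < real n" by linarith
    have nd: "1 / real n < d"
      using \<open>1 / d < real n\<close> d n_pos by (simp add: field_simps)
    \<comment> \<open>Each of the first \<open>m\<close> subintervals contributes an error of at
      most \<open>e / 2 / n\<close> by uniform continuity; the errors are added by induction on
      \<open>m\<close>.\<close>
    have "\<bar>(\<Sum>k<m. g (real k / real n)) / real n - integral {0..real m / real n} g\<bar> \<le> real m * (e / 2 / real n)"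
      if "m \<le> n" for m
      using that
    proof (induction m)
      case (Suc m)
      let ?a = "real m / real n" and ?b = "real (Suc m) / real n"
      have ab: "0 \<le> ?a" "?a \<le> ?b" "?b \<le> 1" "?b - ?a = 1 / real n"
        using Suc.prems n_pos by (auto simp: field_simps)
      have int: "g integrable_on {0..?b}" "g integrable_on {?a..?b}"
        using ab by (auto intro!: integrable_continuous_real continuous_on_subset[OF assms] intro: order_trans[OF ab(1)])
      have comb: "integral {0..?b} g = integral {0..?a} g + integral {?a..?b} g"
        using Henstock_Kurzweil_Integration.integral_combine[OF ab(1,2) int(1)] by simp
      have "norm (integral {?a..?b} (\<lambda>x. g x - g ?a)) \<le> e / 2 * (?b - ?a)"
      proof (rule integral_bound)
        show "continuous_on {?a..?b} (\<lambda>x. g x - g ?a)"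
          using ab by (intro continuous_intros continuous_on_subset[OF assms]) auto
        fix x assume x: "x \<in> {?a..?b}"
        then have "dist x ?a < d" using ab nd by (simp add: dist_real_def)
        moreover have "?a \<in> {0..1}" "x \<in> {0..1}"
          using x ab order_trans[OF ab(1)] by auto
        ultimately have "dist (g x) (g ?a) < e / 2" using d(2) by blast
        then show "norm (g x - g ?a) \<le> e / 2" by (simp add: dist_real_def)
      qed (use ab in auto)
      moreover have "integral {?a..?b} (\<lambda>x. g x - g ?a) = integral {?a..?b} g - integral {?a..?b} (\<lambda>x. g ?a)"
        by (rule Henstock_Kurzweil_Integration.integral_diff[OF int(2) integrable_const_ivl])
      moreover have "integral {?a..?b} (\<lambda>x. g ?a) = (?b - ?a) * g ?a" using ab(2) by simp
      then have "integral {?a..?b} (\<lambda>x. g ?a) = g ?a / real n" unfolding ab(4) by simp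
      ultimately have step: "\<bar>g ?a / real n - integral {?a..?b} g\<bar> \<le> e / 2 / real n"
        by (simp only: real_norm_def abs_minus_commute ab(4)) simp
      have IH: "\<bar>(\<Sum>k<m. g (real k / real n)) / real n - integral {0..?a} g\<bar> \<le> real m * (e / 2 / real n)"
        using Suc by simp
      have "(\<Sum>k<Suc m. g (real k / real n)) / real n - integral {0..?b} g
        = ((\<Sum>k<m. g (real k / real n)) / real n - integral {0..?a} g) + (g ?a / real n - integral {?a..?b} g)"
        unfolding comb by (simp add: add_divide_distrib)
      moreover have "real (Suc m) * (e / 2 / real n) = real m * (e / 2 / real n) + e / 2 / real n"
        by (simp only: of_nat_Suc distrib_right mult_1_left)
      ultimately show ?case using step IH by linarith
    qed simp
    from this[of n] have "\<bar>(\<Sum>k<n. g (real k / real n)) / real n - integral {0..1} g\<bar> \<le> e / 2"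
      using n_pos by simp
    then show ?thesis using e by simp
  qed
  then show "\<exists>n0. \<forall>n\<ge>n0. norm ((\<Sum>k<n. g (real k / real n)) / real n - integral {0..1} g) < e"
    by blast
qed

text \<open>The derivative has the sign of \<open>t * cos t - sin t\<close>, which starts at 0 and
  has derivative \<open>- (t * sin t)\<close>. The monotonicity yields the single sign change in
  \<open>integral_exp_cos_le_gauss\<close>.\<close>

lemma sin_div_antimono:
  fixes x y :: real
  assumes "0 < x" "x \<le> y" "y \<le> pi"
  shows "sin y / y \<le> sin x / x"
proof (rule DERIV_nonpos_imp_nonincreasing[OF assms(2), where f = "\<lambda>t. sin t / t"])
  fix t assume t: "x \<le> t" "t \<le> y"
  then have t0: "0 < t" "t \<le> pi" using assms by auto
  have "t * cos t - sin t \<le> 0 * cos 0 - sin 0"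
  proof (rule DERIV_nonpos_imp_nonincreasing[where f = "\<lambda>t. t * cos t - sin t"])
    fix r assume r: "0 \<le> r" "r \<le> t"
    have "((\<lambda>t. t * cos t - sin t) has_real_derivative - (r * sin r)) (at r)"
      by (auto intro!: derivative_eq_intros simp: algebra_simps)
    moreover have "- (r * sin r) \<le> 0" using r t0 by (simp add: sin_ge_zero)
    ultimately show "\<exists>D. ((\<lambda>t. t * cos t - sin t) has_real_derivative D) (at r) \<and> D \<le> 0" by blast
  qed (use t0 in simp)
  then have "(t * cos t - sin t) / t\<^sup>2 \<le> 0" using t0 by (simp add: divide_le_0_iff)
  moreover have "((\<lambda>t. sin t / t) has_real_derivative (t * cos t - sin t) / t\<^sup>2) (at t)"
    using t0 by (auto intro!: derivative_eq_intros simp: power2_eq_square)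
  ultimately show "\<exists>D. ((\<lambda>t. sin t / t) has_real_derivative D) (at t) \<and> D \<le> 0" by blast
qed

text \<open>
  With \<open>X u = 1 - cos (\<pi> u)\<close> and \<open>Y u = 3 u\<^sup>2\<close>, both increasing with integral \<open>1\<close>, the
  difference \<open>Y - X\<close> changes sign only once, at some \<open>c\<close>, from negative to positive; so
  convexity gives \<open>exp (- l Y) - exp (- l X) \<ge> - l exp (- l X) (Y - X) \<ge> - l exp (- l X c) (Y - X)\<close>.
\<close>
lemma integral_exp_cos_le_gauss:
  fixes l :: real
  assumes l: "l \<ge> 0"
  shows "integral {0..1} (\<lambda>u. exp (- l * (1 - cos (pi * u)))) \<le> integral {0..1} (\<lambda>u. exp (- l * (3 * u\<^sup>2)))"
proof -
  define X where "X u = 1 - cos (pi * u)" for u :: real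
  define Y where "Y u = 3 * u\<^sup>2" for u :: real
  define r where "r u = sin (pi * u / 2) / (pi * u / 2)" for u :: real
  have X_half: "X u = 2 * (sin (pi * u / 2))\<^sup>2" for u
    using cos_double_sin[of "pi * u / 2"] by (simp add: X_def)
  \<comment> \<open>As \<open>1 - cos x\<close> is twice the squared sine of \<open>x / 2\<close>,
    the sign of \<open>Y u - X u\<close> is that of a bracket which increases with \<open>u\<close>
    because \<open>r\<close> decreases.\<close>
  have diff: "Y u - X u = u\<^sup>2 * (3 - pi\<^sup>2 / 2 * (r u)\<^sup>2)" if "u > 0" for u
    using that by (simp add: X_half Y_def r_def power_divide power_mult_distrib field_simps)
  have r_mono: "r y \<le> r x" "0 \<le> r x" if "0 < x" "x \<le> y" "y \<le> 1" for x y
  proof -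
    have half: "0 < pi * x / 2" "pi * x / 2 \<le> pi * y / 2" "pi * y / 2 \<le> pi"
      using that pi_gt_zero mult_left_mono[of y 1 pi] mult_left_mono[of x y pi] by simp_all
    then show "r y \<le> r x" unfolding r_def by (rule sin_div_antimono)
    show "0 \<le> r x" unfolding r_def using half by (intro divide_nonneg_nonneg sin_ge_zero) auto
  qed
  have sgn_mono: "Y y - X y \<ge> 0" if "0 < x" "x \<le> y" "y \<le> 1" "Y x - X x \<ge> 0" for x y
  proof -
    have "0 \<le> 3 - pi\<^sup>2 / 2 * (r x)\<^sup>2"
      using that diff[of x] by (simp add: zero_le_mult_iff)
    moreover have "pi\<^sup>2 / 2 * (r y)\<^sup>2 \<le> pi\<^sup>2 / 2 * (r x)\<^sup>2"
      using that r_mono[of x y] r_mono[of y y] by (intro mult_left_mono power_mono) auto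
    ultimately have "0 \<le> 3 - pi\<^sup>2 / 2 * (r y)\<^sup>2" by linarith
    then have "0 \<le> y\<^sup>2 * (3 - pi\<^sup>2 / 2 * (r y)\<^sup>2)" by (intro mult_nonneg_nonneg) auto
    then show ?thesis using that diff[of y] by simp
  qed
  \<comment> \<open>The point of the sign change. The set is nonempty since
    \<open>Y 1 - X 1 = 3 - 2\<close>.\<close>
  define c where "c = Inf {u. 0 < u \<and> u \<le> 1 \<and> Y u - X u \<ge> 0}"
  have one: "1 \<in> {u. 0 < u \<and> u \<le> 1 \<and> Y u - X u \<ge> 0}" by (simp add: X_def Y_def)
  have bdd: "bdd_below {u. 0 < u \<and> u \<le> 1 \<and> Y u - X u \<ge> 0}" by (rule bdd_belowI[of _ 0]) auto
  have c: "0 \<le> c" "c \<le> 1"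
    using one bdd by (auto simp: c_def intro!: cInf_greatest cInf_lower)
  have above: "Y u - X u \<ge> 0" if u: "c < u" "u \<le> 1" for u
  proof -
    obtain x where "0 < x" "x \<le> 1" "Y x - X x \<ge> 0" "x < u"
      using u(1) one cInf_less_iff[OF _ bdd, of u] unfolding c_def by blast
    then show ?thesis using sgn_mono[of x u] u by simp
  qed
  have below: "Y u - X u \<le> 0" if u: "0 \<le> u" "u < c" for u
  proof (rule ccontr)
    assume *: "\<not> Y u - X u \<le> 0"
    then have "u \<noteq> 0" by (auto simp: X_def Y_def)
    then have "c \<le> u" using u c * unfolding c_def by (intro cInf_lower bdd) auto
    then show False using u by simp
  qed
  have X_mono: "X x \<le> X y" if "0 \<le> x" "x \<le> y" "y \<le> 1" for x y
    using that unfolding X_def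
    by (auto intro!: cos_monotone_0_pi_le simp: mult_le_cancel_left1 pi_ge_zero)
  have pointwise: "exp (- l * X u) - l * exp (- l * X c) * (Y u - X u) \<le> exp (- l * Y u)" if u: "u \<in> {0..1}" for u
  proof -
    \<comment> \<open>The exponential lies above its tangent line at
      \<open>- l * X u\<close>.\<close>
    have "exp (- l * X u) * (1 + (- l * (Y u - X u))) \<le> exp (- l * X u) * exp (- l * (Y u - X u))"
      by (intro mult_left_mono exp_ge_add_one_self) auto
    also have "\<dots> = exp (- l * Y u)" by (simp add: algebra_simps flip: exp_add)
    finally have 1: "exp (- l * X u) - l * (exp (- l * X u) * (Y u - X u)) \<le> exp (- l * Y u)"
      by (simp add: algebra_simps)
    have "exp (- l * X u) * (Y u - X u) \<le> exp (- l * X c) * (Y u - X u)"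
    proof (cases u c rule: linorder_cases)
      case less
      then have "X u \<le> X c" using u c by (intro X_mono) auto
      then have "exp (- l * X c) \<le> exp (- l * X u)" using l by (simp add: mult_left_mono)
      then show ?thesis using below[of u] less u by (intro mult_right_mono_neg) auto
    next
      case greater
      then have "X c \<le> X u" using u c by (intro X_mono) auto
      then have "exp (- l * X u) \<le> exp (- l * X c)" using l by (simp add: mult_left_mono)
      then show ?thesis using above[of u] greater u by (intro mult_right_mono) auto
    qed simp
    then have "l * (exp (- l * X u) * (Y u - X u)) \<le> l * (exp (- l * X c) * (Y u - X u))"
      using l by (rule mult_left_mono)
    then show ?thesis using 1 by (simp add: mult.assoc)
  qed
  \<comment> \<open>The antiderivative \<open>u ^ 3 - u + sin (pi * u) / pi\<close> vanishes at both
    ends; the factor 3 in \<open>Y\<close> is chosen for these equal means.\<close>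
  have "((\<lambda>u. Y u - X u) has_integral ((1 ^ 3 - 1 + sin (pi * 1) / pi) - (0 ^ 3 - 0 + sin (pi * 0) / pi))) {0..1}"
    unfolding X_def Y_def
    by (intro fundamental_theorem_of_calculus)
      (auto intro!: derivative_eq_intros simp flip: has_real_derivative_iff_has_vector_derivative)
  then have YX: "((\<lambda>u. Y u - X u) has_integral 0) {0..1}" by simp
  have contX: "(\<lambda>u. exp (- l * X u)) integrable_on {0..1}" "(\<lambda>u. exp (- l * Y u)) integrable_on {0..1}"
    unfolding X_def Y_def by (intro integrable_continuous_real continuous_intros)+
  have "((\<lambda>u. exp (- l * X u) - l * exp (- l * X c) * (Y u - X u)) has_integral
      (integral {0..1} (\<lambda>u. exp (- l * X u)) - l * exp (- l * X c) * 0)) {0..1}"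
    by (intro has_integral_diff has_integral_mult_right YX integrable_integral contX)
  then have "integral {0..1} (\<lambda>u. exp (- l * X u)) - l * exp (- l * X c) * 0 \<le> integral {0..1} (\<lambda>u. exp (- l * Y u))"
    by (rule has_integral_le[OF _ integrable_integral[OF contX(2)] pointwise])
  then show ?thesis by (simp add: X_def Y_def)
qed

text \<open>The Riemann sums run over a full period of the cosine, whereas the Gaussian comparison
  needs the half period on which \<open>1 - cos\<close> increases. The reflection of
  \<open>u\<close> to \<open>2 - u\<close> identifies the two halves.\<close>

lemma integral_exp_cos_double:
  fixes l :: real
  shows "integral {0..1} (\<lambda>u. exp (- l * (1 - cos (2 * pi * u)))) = integral {0..1} (\<lambda>u. exp (- l * (1 - cos (pi * u))))"
proof -
  define g where "g u = exp (- l * (1 - cos (pi * u)))" for u :: real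
  have cont: "continuous_on S g" for S unfolding g_def by (intro continuous_intros)
  have int: "g integrable_on {x..y}" for x y by (rule integrable_continuous_real[OF cont])
  have "((\<lambda>u. g (- 1 * u + 2)) has_integral (1 / \<bar>- 1\<bar> * integral {0..1} g)) ((\<lambda>x. 1 / (- 1) * x + - (1 / (- 1) * 2)) ` {0..1})"
    using has_integral_affinity[of g "integral {0..1} g" 0 1 "-1" 2] int[of 0 1]
    by (simp add: has_integral_integrable_integral)
  moreover have "(\<lambda>x. 1 / (- 1) * x + - (1 / (- 1) * 2)) ` {0..1} = {1..2::real}"
    by (auto simp: image_iff intro!: bexI[of _ "2 - x" for x])
  moreover have "g (- 1 * u + 2) = g u" for u
    using cos_periodic[of "- (pi * u)"] by (simp add: g_def algebra_simps)
  ultimately have "integral {1..2} g = integral {0..1} g" by (simp add: integral_unique)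
  moreover have "integral {0..2} g = integral {0..1} g + integral {1..2} g"
    using Henstock_Kurzweil_Integration.integral_combine[of 0 1 2 g] int by simp
  moreover have "((\<lambda>u. g (2 * u + 0)) has_integral (1 / \<bar>2\<bar> * integral {0..2} g)) ((\<lambda>x. 1 / 2 * x + - (1 / 2 * 0)) ` {0..2})"
    using has_integral_affinity[of g "integral {0..2} g" 0 2 2 0] int[of 0 2]
    by (simp add: has_integral_integrable_integral)
  moreover have "(\<lambda>x. 1 / 2 * x + - (1 / 2 * 0)) ` {0..2} = {0..1::real}"
    by (auto simp: image_iff intro!: bexI[of _ "2 * x" for x])
  ultimately have "integral {0..1} (\<lambda>u. g (2 * u)) = integral {0..1} g"
    by (simp add: integral_unique)
  then show ?thesis by (simp add: g_def[abs_def] mult_ac)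
qed

section \<open>Truncated Gaussian integrals\<close>

lemma integral_gauss_scale:
  fixes R :: real
  assumes R: "R > 0"
  shows "integral {0..1} (\<lambda>u. exp (- ((R * u)\<^sup>2 / 2))) = integral {0..R} (\<lambda>t. exp (- (t\<^sup>2 / 2))) / R"
proof -
  define g where "g t = exp (- (t\<^sup>2 / 2))" for t :: real
  have "g integrable_on {0..R}" unfolding g_def by (intro integrable_continuous_real continuous_intros) auto
  then have "((\<lambda>u. g (R * u + 0)) has_integral (1 / \<bar>R\<bar> * integral {0..R} g)) ((\<lambda>x. 1 / R * x + - (1 / R * 0)) ` {0..R})"
    using has_integral_affinity[of g "integral {0..R} g" 0 R R 0] R
    by (simp add: has_integral_integrable_integral)
  moreover have "(\<lambda>x. 1 / R * x + - (1 / R * 0)) ` {0..R} = {0..1}"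
    using R by (auto simp: image_iff field_simps intro!: bexI[of _ "R * x" for x])
  ultimately have "((\<lambda>u. g (R * u)) has_integral (integral {0..R} g / R)) {0..1}"
    using R by simp
  then show ?thesis unfolding g_def by (rule integral_unique)
qed

text \<open>With \<open>q = sqrt (1 + t^2 / 3)\<close>, the derivative of \<open>t / q\<close> is
  \<open>1 / q ^ 3\<close>. It dominates the Gaussian because \<open>1 + x <= exp x\<close> at
  \<open>x = t^2 / 3\<close> gives \<open>q <= exp (t^2 / 6)\<close>.\<close>

lemma integral_gauss_le_sqrt:
  fixes R :: real
  assumes R: "R \<ge> 0"
  shows "integral {0..R} (\<lambda>t. exp (- (t\<^sup>2 / 2))) \<le> R / sqrt (1 + R\<^sup>2 / 3)"
proof -
  have pos: "1 + t\<^sup>2 / 3 > 0" for t :: real by (rule add_pos_nonneg) auto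
  have "((\<lambda>t. 1 / (sqrt (1 + t\<^sup>2 / 3)) ^ 3) has_integral (R / sqrt (1 + R\<^sup>2 / 3) - 0 / sqrt (1 + 0\<^sup>2 / 3))) {0..R}"
  proof (rule fundamental_theorem_of_calculus[OF R])
    fix t :: real
    define q where "q = sqrt (1 + t\<^sup>2 / 3)"
    have q: "q > 0" "q\<^sup>2 = 1 + t\<^sup>2 / 3" using pos[of t] by (auto simp: q_def)
    have "((\<lambda>t. t / sqrt (1 + t\<^sup>2 / 3)) has_real_derivative (1 * q - t * ((2 * t / 3) * (inverse q / 2))) / (q * q)) (at t)"
      unfolding q_def using pos[of t] by (auto intro!: derivative_eq_intros)
    also have "(1 * q - t * ((2 * t / 3) * (inverse q / 2))) / (q * q) = (q\<^sup>2 - t\<^sup>2 / 3) / q ^ 3"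
      using q(1) by (simp add: field_simps power2_eq_square power3_eq_cube)
    also have "\<dots> = 1 / q ^ 3" using q(2) by simp
    finally have "((\<lambda>t. t / sqrt (1 + t\<^sup>2 / 3)) has_real_derivative 1 / (sqrt (1 + t\<^sup>2 / 3)) ^ 3) (at t within {0..R})"
      unfolding q_def by (rule has_field_derivative_at_within)
    then show "((\<lambda>t. t / sqrt (1 + t\<^sup>2 / 3)) has_vector_derivative 1 / (sqrt (1 + t\<^sup>2 / 3)) ^ 3) (at t within {0..R})"
      by (rule has_real_derivative_iff_has_vector_derivative[THEN iffD1])
  qed
  moreover have "(\<lambda>t. exp (- (t\<^sup>2 / 2))) integrable_on {0..R}"
    by (intro integrable_continuous_real continuous_intros) auto
  moreover have "exp (- (t\<^sup>2 / 2)) \<le> 1 / (sqrt (1 + t\<^sup>2 / 3)) ^ 3" for t :: real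
  proof -
    have "sqrt (1 + t\<^sup>2 / 3) \<le> exp (t\<^sup>2 / 6)"
    proof (rule real_le_lsqrt)
      show "1 + t\<^sup>2 / 3 \<le> (exp (t\<^sup>2 / 6))\<^sup>2"
        using exp_ge_add_one_self[of "t\<^sup>2 / 3"] by (simp flip: exp_of_nat_mult)
    qed auto
    then have "(sqrt (1 + t\<^sup>2 / 3)) ^ 3 \<le> exp (t\<^sup>2 / 6) ^ 3" by (rule power_mono) simp
    also have "\<dots> = exp (t\<^sup>2 / 2)" by (simp flip: exp_of_nat_mult)
    finally show ?thesis using pos[of t] by (simp add: exp_minus field_simps)
  qed
  ultimately show ?thesis using has_integral_le[OF integrable_integral] by fastforce
qed

text \<open>The integral over the whole half-line is an upper bound, and a rescaling by
  \<open>sqrt 2\<close> reduces it to \<open>gaussian_moment_0\<close>.\<close>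

lemma integral_gauss_le_pi:
  fixes R :: real
  shows "integral {0..R} (\<lambda>t. exp (- (t\<^sup>2 / 2))) \<le> sqrt (pi / 2)"
proof -
  have "has_bochner_integral lborel (\<lambda>x. indicator {0..} x *\<^sub>R exp (- x\<^sup>2)) (sqrt pi / 2)"
    by (rule gaussian_moment_0)
  then have "has_bochner_integral lborel (\<lambda>x. indicator {0..} (0 + 1 / sqrt 2 * x) *\<^sub>R exp (- (0 + 1 / sqrt 2 * x)\<^sup>2)) ((sqrt pi / 2) /\<^sub>R \<bar>1 / sqrt 2\<bar>)"
    by (subst lborel_has_bochner_integral_real_affine_iff[where c = "sqrt 2" and t = 0]) (auto simp: field_simps)
  then have "((\<lambda>x. indicator {0..} (0 + 1 / sqrt 2 * x) *\<^sub>R exp (- (0 + 1 / sqrt 2 * x)\<^sup>2)) has_integral ((sqrt pi / 2) /\<^sub>R \<bar>1 / sqrt 2\<bar>)) UNIV"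
    by (auto simp only: has_bochner_integral_iff dest: has_integral_integral_lborel)
  also have "(\<lambda>x::real. indicator {0..} (0 + 1 / sqrt 2 * x) *\<^sub>R exp (- (0 + 1 / sqrt 2 * x)\<^sup>2)) = (\<lambda>x. if x \<in> {0..} then exp (- (x\<^sup>2 / 2)) else 0)"
    by (auto simp: fun_eq_iff indicator_def power_divide zero_le_divide_iff)
  finally have int: "((\<lambda>x::real. exp (- (x\<^sup>2 / 2))) has_integral ((sqrt pi / 2) /\<^sub>R \<bar>1 / sqrt 2\<bar>)) {0..}"
    by (simp only: has_integral_restrict_UNIV)
  have "(\<lambda>t::real. exp (- (t\<^sup>2 / 2))) integrable_on {0..R}"
    by (intro integrable_continuous_real continuous_intros) auto
  then have "integral {0..R} (\<lambda>t. exp (- (t\<^sup>2 / 2))) \<le> (sqrt pi / 2) /\<^sub>R \<bar>1 / sqrt 2\<bar>"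
    by (intro has_integral_subset_le[OF _ integrable_integral int]) auto
  also have "\<dots> = sqrt (pi / 2)" by (simp add: real_sqrt_divide field_simps)
  finally show ?thesis .
qed

section \<open>Weighted sums modulo a prime\<close>

text \<open>Dirichlet gives one multiplier \<open>q\<close> for which every \<open>q * v i\<close>
  is close to an integer \<open>w i\<close>. Errors over a subset add up to less than 1/2, so
  rounding \<open>q\<close> times a subset sum of \<open>v\<close> recovers that of
  \<open>w\<close>.\<close>

lemma integer_weights:
  fixes v :: "'i \<Rightarrow> real"
  assumes fin: "finite I" and v: "\<And>i. i \<in> I \<Longrightarrow> v i \<noteq> 0"
  shows "\<exists>(w :: 'i \<Rightarrow> int) (h :: real \<Rightarrow> int). (\<forall>i\<in>I. w i \<noteq> 0) \<and> (\<forall>J\<subseteq>I. h (\<Sum>i\<in>J. v i) = (\<Sum>i\<in>J. w i))"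
proof -
  obtain e where e: "bij_betw e {..<card I} I"
    using ex_bij_betw_nat_finite[OF fin] by (auto simp: atLeast0LessThan)
  define idx where "idx = the_inv_into {..<card I} e"
  have idx: "idx i < card I" "e (idx i) = i" if "i \<in> I" for i
    using e that the_inv_into_into[of e "{..<card I}" i "{..<card I}"] f_the_inv_into_f[of e "{..<card I}" i]
    by (auto simp: idx_def bij_betw_def)
  define m where "m = Min (insert 1 ((\<lambda>i. \<bar>v i\<bar>) ` I))"
  have m: "m > 0" "\<And>i. i \<in> I \<Longrightarrow> m \<le> \<bar>v i\<bar>"
    using fin v by (auto simp: m_def)
  \<comment> \<open>The first lower bound keeps each \<open>w i\<close> away from 0, the second
    keeps the total error below 1/2.\<close>
  obtain P :: nat where P: "max (1 / m) (2 * real (card I)) < real P"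
    using reals_Archimedean2 by blast
  then have P1: "1 / m < real P" and P2: "2 * real (card I) < real P" by auto
  have P0: "real P > 0" using P2 by (smt (verit) of_nat_0_le_iff)
  obtain q :: int and u :: "nat \<Rightarrow> int" where q: "0 < q"
    and u: "\<And>j. j < card I \<Longrightarrow> \<bar>of_int q * v (e j) - of_int (u j)\<bar> < 1 / real P"
    by (rule Dirichlet_approx_simult[of P "card I" "\<lambda>j. v (e j)"]) (use P0 in auto)
  define w where "w i = u (idx i)" for i
  have w: "\<bar>of_int q * v i - of_int (w i)\<bar> < 1 / real P" if "i \<in> I" for i
    using u[OF idx(1)[OF that]] idx(2)[OF that] by (simp add: w_def)
  show ?thesis
  proof (intro exI conjI ballI allI impI)
    fix i assume i: "i \<in> I"
    show "w i \<noteq> 0"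
    proof
      assume "w i = 0"
      then have "real_of_int q * \<bar>v i\<bar> < 1 / real P"
        using w[OF i] q by (simp add: abs_mult)
      moreover have "1 * m \<le> real_of_int q * \<bar>v i\<bar>"
        using q m i by (intro mult_mono) auto
      moreover have "1 / real P < m" using P0 P1 m by (simp add: field_simps)
      ultimately show False by simp
    qed
  next
    fix J assume J: "J \<subseteq> I"
    have "\<bar>of_int q * (\<Sum>i\<in>J. v i) - of_int (\<Sum>i\<in>J. w i)\<bar> = \<bar>\<Sum>i\<in>J. of_int q * v i - of_int (w i)\<bar>"
      by (simp add: sum_subtractf sum_distrib_left)
    also have "\<dots> \<le> (\<Sum>i\<in>J. 1 / real P)"
      using w J by (intro order_trans[OF sum_abs] sum_mono less_imp_le) auto
    also have "\<dots> \<le> real (card I) / real P"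
      using card_mono[OF fin J] by (simp add: divide_right_mono)
    also have "\<dots> < 1 / 2" using P0 P2 by (simp add: field_simps)
    finally show "round (of_int q * (\<Sum>i\<in>J. v i)) = (\<Sum>i\<in>J. w i)"
      by (intro round_unique') simp
  qed
qed

text \<open>The squared modulus is exactly \<open>1 - 2 * p * (1 - p) * (1 - cos t)\<close>, to
  which \<open>1 + x <= exp x\<close> applies.\<close>

lemma norm_bernoulli_char_le:
  fixes p t :: real
  assumes p: "p \<in> {0..1}"
  shows "norm (of_real p * cis t + of_real (1 - p)) \<le> exp (- (p * (1 - p) * (1 - cos t)))"
proof (rule power2_le_imp_le)
  have "(norm (of_real p * cis t + of_real (1 - p)))\<^sup>2 = (p * cos t + (1 - p))\<^sup>2 + (p * sin t)\<^sup>2"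
    by (simp add: cmod_power2)
  also have "\<dots> = p\<^sup>2 * ((cos t)\<^sup>2 + (sin t)\<^sup>2) + 2 * p * (1 - p) * cos t + (1 - p)\<^sup>2"
    by (simp only: power2_eq_square ring_distribs) (simp add: algebra_simps)
  also have "\<dots> = 1 + - (2 * (p * (1 - p) * (1 - cos t)))"
    by (simp add: power2_eq_square algebra_simps)
  also have "\<dots> \<le> exp (- (2 * (p * (1 - p) * (1 - cos t))))"
    by (rule exp_ge_add_one_self)
  also have "\<dots> = (exp (- (p * (1 - p) * (1 - cos t))))\<^sup>2"
    by (simp flip: exp_of_nat_mult)
  finally show "(norm (of_real p * cis t + of_real (1 - p)))\<^sup>2 \<le> (exp (- (p * (1 - p) * (1 - cos t))))\<^sup>2" .
qed simp

text \<open>The probability that, among the independent variables indexed by \<open>I\<close>, those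
  in \<open>J\<close> are 1 and the others 0.\<close>

definition subset_weight :: "('i \<Rightarrow> real) \<Rightarrow> 'i set \<Rightarrow> 'i set \<Rightarrow> real" where
  "subset_weight p I J = (\<Prod>i\<in>J. p i) * (\<Prod>i\<in>I - J. 1 - p i)"

lemma subset_weight_nonneg:
  assumes "\<And>i. i \<in> I \<Longrightarrow> p i \<in> {0..1}" "J \<subseteq> I"
  shows "0 \<le> subset_weight p I J"
  using assms by (auto simp: subset_weight_def subset_iff intro!: mult_nonneg_nonneg prod_nonneg)

lemma sum_subset_weight:
  assumes "finite I"
  shows "(\<Sum>J\<in>Pow I. subset_weight p I J) = 1"
  using prod_add[OF assms, of p "\<lambda>i. 1 - p i"] by (simp add: subset_weight_def)

text \<open>The law of the integer-weighted sum modulo \<open>N\<close>, in combinatorial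
  form.\<close>

definition residue_mass :: "('i \<Rightarrow> real) \<Rightarrow> 'i set \<Rightarrow> ('i \<Rightarrow> int) \<Rightarrow> int \<Rightarrow> int \<Rightarrow> real" where
  "residue_mass p I w N r = (\<Sum>J\<in>{J\<in>Pow I. (\<Sum>i\<in>J. w i) mod N = r}. subset_weight p I J)"

lemma sum_residue_mass:
  fixes g :: "int \<Rightarrow> 'a::{comm_ring_1,real_algebra_1}"
  assumes "finite I" "N > 0"
  shows "(\<Sum>r\<in>{0..<N}. of_real (residue_mass p I w N r) * g r)
    = (\<Sum>J\<in>Pow I. of_real (subset_weight p I J) * g ((\<Sum>i\<in>J. w i) mod N))"
proof -
  have "(\<Sum>r\<in>{0..<N}. of_real (residue_mass p I w N r) * g r)
    = (\<Sum>r\<in>{0..<N}. \<Sum>J\<in>{J\<in>Pow I. (\<Sum>i\<in>J. w i) mod N = r}. of_real (subset_weight p I J) * g ((\<Sum>i\<in>J. w i) mod N))"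
    by (simp add: residue_mass_def sum_distrib_right)
  also have "\<dots> = (\<Sum>J\<in>Pow I. of_real (subset_weight p I J) * g ((\<Sum>i\<in>J. w i) mod N))"
    using assms by (intro sum.group) auto
  finally show ?thesis .
qed

text \<open>Expanding the product over subsets of \<open>I\<close> produces the transform: the
  characteristic function of an independent sum factorises.\<close>

lemma zn_fourier_residue_mass:
  assumes "finite I" "N > 0"
  shows "zn_fourier N (residue_mass p I w N) k
    = (\<Prod>i\<in>I. of_real (p i) * zn_char N (k * w i) + of_real (1 - p i))"
proof -
  have "zn_fourier N (residue_mass p I w N) k = (\<Sum>J\<in>Pow I. of_real (subset_weight p I J) * zn_char N (k * ((\<Sum>i\<in>J. w i) mod N)))"
    unfolding zn_fourier_def by (rule sum_residue_mass[OF assms])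
  also have "\<dots> = (\<Sum>J\<in>Pow I. of_real (subset_weight p I J) * (\<Prod>i\<in>J. zn_char N (k * w i)))"
  proof (rule sum.cong[OF refl])
    fix J
    have "zn_char N (k * ((\<Sum>i\<in>J. w i) mod N)) = zn_char N (k * (\<Sum>i\<in>J. w i))"
      by (rule zn_char_cong[OF assms(2)]) (simp add: cong_def mod_mult_right_eq)
    then show "of_real (subset_weight p I J) * zn_char N (k * ((\<Sum>i\<in>J. w i) mod N)) = of_real (subset_weight p I J) * (\<Prod>i\<in>J. zn_char N (k * w i))"
      by (simp add: sum_distrib_left zn_char_sum)
  qed
  also have "\<dots> = (\<Prod>i\<in>I. of_real (p i) * zn_char N (k * w i) + of_real (1 - p i))"
    unfolding prod_add[OF assms(1)] by (simp add: subset_weight_def prod.distrib mult_ac)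
  finally show ?thesis .
qed

text \<open>
  Jensen's inequality with weights \<open>p i (1 - p i) / s\<close> plays the role of Hoelder's inequality; the
  summands then agree since multiplication by \<open>w i\<close> permutes the residues modulo \<open>N\<close>.
\<close>
lemma sum_zn_fourier_residue_mass_le:
  fixes a :: real
  assumes fin: "finite I" and N: "N > 0" and a: "a > 0"
    and p: "\<And>i. i \<in> I \<Longrightarrow> p i \<in> {0..1}"
    and w: "\<And>i. i \<in> I \<Longrightarrow> coprime (w i) N"
    and s: "s = (\<Sum>i\<in>I. p i * (1 - p i))" "s > 0"
  shows "(\<Sum>k\<in>{0..<N}. norm (zn_fourier N (residue_mass p I w N) k) powr a)
    \<le> (\<Sum>k\<in>{0..<N}. exp (- (a * s) * (1 - cos (2 * pi * of_int k / of_int N))))"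
proof -
  define c where "c i = p i * (1 - p i)" for i
  have c: "c i \<ge> 0" if "i \<in> I" for i using p[OF that] by (simp add: c_def)
  define E where "E m = exp (- (a * s) * (1 - Re (zn_char N m)))" for m
  have I: "I \<noteq> {}" using s by auto
  have "(\<Sum>k\<in>{0..<N}. norm (zn_fourier N (residue_mass p I w N) k) powr a) \<le> (\<Sum>k\<in>{0..<N}. \<Sum>i\<in>I. c i / s * E (k * w i))"
  proof (rule sum_mono)
    fix k
    have "norm (zn_fourier N (residue_mass p I w N) k) \<le> (\<Prod>i\<in>I. exp (- (c i * (1 - Re (zn_char N (k * w i))))))"
      unfolding zn_fourier_residue_mass[OF fin N] prod_norm[symmetric]
    proof (intro prod_mono conjI)
      fix i assume "i \<in> I"
      then show "norm (of_real (p i) * zn_char N (k * w i) + of_real (1 - p i)) \<le> exp (- (c i * (1 - Re (zn_char N (k * w i)))))"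
        using norm_bernoulli_char_le[OF p] by (simp add: zn_char_def c_def)
    qed simp
    also have "\<dots> = exp (\<Sum>i\<in>I. - (c i * (1 - Re (zn_char N (k * w i)))))"
      using fin by (simp add: exp_sum)
    finally have "norm (zn_fourier N (residue_mass p I w N) k) powr a \<le> exp (\<Sum>i\<in>I. - (c i * (1 - Re (zn_char N (k * w i))))) powr a"
      using a by (intro powr_mono2) auto
    \<comment> \<open>Writing \<open>c i\<close> as \<open>c i / s\<close> times \<open>s\<close>
      exhibits a convex combination, since the \<open>c i / s\<close> sum to 1.\<close>
    also have "\<dots> = exp (\<Sum>i\<in>I. (c i / s) *\<^sub>R (- (a * s) * (1 - Re (zn_char N (k * w i)))))"
      using s(2) by (simp add: powr_def sum_distrib_left mult_ac)
    also have "\<dots> \<le> (\<Sum>i\<in>I. c i / s * E (k * w i))"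
      unfolding E_def using fin I s c
      by (intro convex_on_sum[OF _ _ exp_convex]) (auto simp: c_def simp flip: sum_divide_distrib)
    finally show "norm (zn_fourier N (residue_mass p I w N) k) powr a \<le> (\<Sum>i\<in>I. c i / s * E (k * w i))" .
  qed
  also have "\<dots> = (\<Sum>i\<in>I. c i / s * (\<Sum>k\<in>{0..<N}. E (k * w i)))"
    by (subst sum.swap) (simp add: sum_distrib_left)
  also have "\<dots> = (\<Sum>i\<in>I. c i / s * (\<Sum>k\<in>{0..<N}. E k))"
  proof (rule sum.cong[OF refl])
    fix i assume i: "i \<in> I"
    have "E (k * w i) = E ((w i * k + 0) mod N)" for k
      unfolding E_def by (subst zn_char_cong[OF N, of "k * w i" "(w i * k + 0) mod N"]) (simp_all add: cong_def mult.commute)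
    then show "c i / s * (\<Sum>k\<in>{0..<N}. E (k * w i)) = c i / s * (\<Sum>k\<in>{0..<N}. E k)"
      using sum_affine_mod[OF N w[OF i], of E 0] by simp
  qed
  also have "\<dots> = (\<Sum>i\<in>I. c i / s) * (\<Sum>k\<in>{0..<N}. E k)"
    by (simp add: sum_distrib_right)
  also have "(\<Sum>i\<in>I. c i / s) = 1" using s by (simp add: c_def flip: sum_divide_distrib)
  finally show ?thesis by (simp add: E_def zn_char_def)
qed

definition subset_sum_mass :: "('i \<Rightarrow> real) \<Rightarrow> 'i set \<Rightarrow> ('i \<Rightarrow> real) \<Rightarrow> real \<Rightarrow> real" where
  "subset_sum_mass p I v x = (\<Sum>J\<in>{J\<in>Pow I. (\<Sum>i\<in>J. v i) = x}. subset_weight p I J)"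

lemma subset_sum_mass_nonneg:
  assumes "\<And>i. i \<in> I \<Longrightarrow> p i \<in> {0..1}"
  shows "0 \<le> subset_sum_mass p I v x"
  unfolding subset_sum_mass_def using assms by (intro sum_nonneg subset_weight_nonneg) auto

lemma residue_mass_nonneg:
  assumes "\<And>i. i \<in> I \<Longrightarrow> p i \<in> {0..1}"
  shows "0 \<le> residue_mass p I w N r"
  unfolding residue_mass_def using assms by (intro sum_nonneg subset_weight_nonneg) auto

text \<open>All subsets with \<open>v\<close>-sum \<open>x\<close> have \<open>w\<close>-sum
  \<open>h x\<close>, so they fall into one residue class.\<close>

lemma subset_sum_mass_le_residue_mass:
  assumes "finite I" "\<And>i. i \<in> I \<Longrightarrow> p i \<in> {0..1}"
    and "\<And>J. J \<subseteq> I \<Longrightarrow> h (\<Sum>i\<in>J. v i) = (\<Sum>i\<in>J. w i)"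
  shows "subset_sum_mass p I v x \<le> residue_mass p I w N (h x mod N)"
  unfolding subset_sum_mass_def residue_mass_def
  using assms by (intro sum_mono2) (auto intro!: subset_weight_nonneg)

text \<open>Merging atoms increases a sum of powers: one factor of each mass is kept, the remaining
  \<open>\<alpha> - 1\<close> are bounded by the mass of the residue class, and the subsets are
  regrouped by residue.\<close>

lemma sum_subset_sum_mass_powr_le:
  fixes \<alpha> :: real
  assumes fin: "finite I" and N: "N > 0" and p: "\<And>i. i \<in> I \<Longrightarrow> p i \<in> {0..1}"
    and h: "\<And>J. J \<subseteq> I \<Longrightarrow> h (\<Sum>i\<in>J. v i) = (\<Sum>i\<in>J. w i)" and \<alpha>: "\<alpha> \<ge> 1"
  shows "(\<Sum>x\<in>(\<lambda>J. \<Sum>i\<in>J. v i) ` Pow I. subset_sum_mass p I v x powr \<alpha>)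
    \<le> (\<Sum>r\<in>{0..<N}. residue_mass p I w N r powr \<alpha>)"
proof -
  let ?V = "(\<lambda>J. \<Sum>i\<in>J. v i) ` Pow I"
  have split: "y powr \<alpha> = y * y powr (\<alpha> - 1)" if "y \<ge> 0" for y :: real
    using that by (cases "y = 0") (simp_all add: powr_mult_base)
  have "(\<Sum>x\<in>?V. subset_sum_mass p I v x powr \<alpha>)
    \<le> (\<Sum>x\<in>?V. subset_sum_mass p I v x * residue_mass p I w N (h x mod N) powr (\<alpha> - 1))"
  proof (rule sum_mono)
    fix x
    have 0: "0 \<le> subset_sum_mass p I v x" by (intro subset_sum_mass_nonneg p)
    have "subset_sum_mass p I v x \<le> residue_mass p I w N (h x mod N)"
      by (intro subset_sum_mass_le_residue_mass fin p h)
    then show "subset_sum_mass p I v x powr \<alpha> \<le> subset_sum_mass p I v x * residue_mass p I w N (h x mod N) powr (\<alpha> - 1)"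
      unfolding split[OF 0] using 0 \<alpha> by (intro mult_left_mono powr_mono2) auto
  qed
  also have "\<dots> = (\<Sum>x\<in>?V. \<Sum>J\<in>{J\<in>Pow I. (\<Sum>i\<in>J. v i) = x}.
      subset_weight p I J * residue_mass p I w N ((\<Sum>i\<in>J. w i) mod N) powr (\<alpha> - 1))"
    unfolding subset_sum_mass_def sum_distrib_right using h by (intro sum.cong) auto
  also have "\<dots> = (\<Sum>J\<in>Pow I. subset_weight p I J * residue_mass p I w N ((\<Sum>i\<in>J. w i) mod N) powr (\<alpha> - 1))"
    using fin by (intro sum.group) auto
  also have "\<dots> = (\<Sum>r\<in>{0..<N}. residue_mass p I w N r * residue_mass p I w N r powr (\<alpha> - 1))"
    using sum_residue_mass[OF fin N, of p w "\<lambda>r. residue_mass p I w N r powr (\<alpha> - 1)"] by simp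
  also have "\<dots> = (\<Sum>r\<in>{0..<N}. residue_mass p I w N r powr \<alpha>)"
    using split residue_mass_nonneg[of I p w N] p by simp
  finally show ?thesis .
qed

lemma le_limit_along_primes:
  fixes X :: "nat \<Rightarrow> real"
  assumes X: "X \<longlonglongrightarrow> L" and le: "\<And>N. prime N \<Longrightarrow> N > n0 \<Longrightarrow> c \<le> X N"
  shows "c \<le> L"
proof (rule ccontr)
  assume "\<not> c \<le> L"
  then have "eventually (\<lambda>n. X n < c) sequentially" by (intro order_tendstoD[OF X]) auto
  then obtain m where m: "\<And>n. n \<ge> m \<Longrightarrow> X n < c" by (auto simp: eventually_sequentially)
  obtain N where "prime N" "N > max m n0" using bigger_prime by blast
  then show False using m[of N] le[of N] by auto
qed

text \<open>Here \<open>a\<close> is the conjugate exponent. For large primes \<open>N\<close> the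
  passage to residues and Hausdorff--Young, or its endpoint if \<open>a = 1\<close>, give a bound by
  the Riemann sum \<open>X N\<close>, whose limit is \<open>L\<close>.\<close>

lemma subset_sum_mass_bounds:
  fixes a :: real and v :: "'i \<Rightarrow> real"
  assumes fin: "finite I" and a: "1 \<le> a" "a \<le> 2"
    and p: "\<And>i. i \<in> I \<Longrightarrow> p i \<in> {0..1}" and v: "\<And>i. i \<in> I \<Longrightarrow> v i \<noteq> 0"
    and s: "s = (\<Sum>i\<in>I. p i * (1 - p i))" "s > 0"
  defines "L \<equiv> integral {0..1} (\<lambda>u. exp (- (a * s) * (1 - cos (2 * pi * u))))"
  shows "a = 1 \<Longrightarrow> subset_sum_mass p I v x \<le> L"
    and "a > 1 \<Longrightarrow> (\<Sum>x\<in>(\<lambda>J. \<Sum>i\<in>J. v i) ` Pow I. subset_sum_mass p I v x powr (a / (a - 1))) \<le> L powr (1 / (a - 1))"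
proof -
  have "\<exists>(w :: 'i \<Rightarrow> int) (h :: real \<Rightarrow> int). (\<forall>i\<in>I. w i \<noteq> 0) \<and> (\<forall>J\<subseteq>I. h (\<Sum>i\<in>J. v i) = (\<Sum>i\<in>J. w i))"
    using fin v by (rule integer_weights)
  then obtain w :: "'i \<Rightarrow> int" and h where w: "\<And>i. i \<in> I \<Longrightarrow> w i \<noteq> 0"
    and h: "\<And>J. J \<subseteq> I \<Longrightarrow> h (\<Sum>i\<in>J. v i) = (\<Sum>i\<in>J. w i)"
    by metis
  define X where "X n = (\<Sum>k<n. exp (- (a * s) * (1 - cos (2 * pi * (real k / real n))))) / real n" for n
  have X: "X \<longlonglongrightarrow> L"
    unfolding X_def L_def by (intro riemann_sum_tendsto continuous_intros)
  \<comment> \<open>A prime beyond \<open>n0\<close> exceeds every \<open>\<bar>w i\<bar>\<close>,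
    so it is coprime to each of these nonzero integers.\<close>
  define n0 where "n0 = nat (\<Sum>i\<in>I. \<bar>w i\<bar>)"
  have mean: "(\<Sum>k\<in>{0..<int N}. norm (zn_fourier (int N) (residue_mass p I w (int N)) k) powr a) / of_int (int N) \<le> X N"
    if N: "prime N" "N > n0" for N
  proof -
    have N0: "int N > 0" using N prime_gt_0_nat by simp
    have "coprime (w i) (int N)" if i: "i \<in> I" for i
    proof -
      have "\<bar>w i\<bar> \<le> (\<Sum>i\<in>I. \<bar>w i\<bar>)" using fin i by (intro member_le_sum) auto
      then have "\<bar>w i\<bar> < int N" using N by (simp add: n0_def)
      then have "\<not> int N dvd w i" using w[OF i] zdvd_not_zless[of "\<bar>w i\<bar>" "int N"] by auto
      then have "coprime (int N) (w i)" using N by (intro prime_imp_coprime) auto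
      then show ?thesis by (simp add: coprime_commute)
    qed
    then have "(\<Sum>k\<in>{0..<int N}. norm (zn_fourier (int N) (residue_mass p I w (int N)) k) powr a)
       \<le> (\<Sum>k\<in>{0..<int N}. exp (- (a * s) * (1 - cos (2 * pi * of_int k / of_int (int N)))))"
      using a by (intro sum_zn_fourier_residue_mass_le[OF fin N0 _ p _ s]) auto
    also have "\<dots> = (\<Sum>k<N. exp (- (a * s) * (1 - cos (2 * pi * (real k / real N)))))"
      by (rule sum.reindex_bij_witness[of _ int nat]) auto
    finally show ?thesis by (simp add: X_def divide_right_mono)
  qed
  {
    assume "a = 1"
    show "subset_sum_mass p I v x \<le> L"
    proof (rule le_limit_along_primes[OF X])
      fix N assume N: "prime N" "N > n0"
      then have N0: "int N > 0" using prime_gt_0_nat by simp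
      have "subset_sum_mass p I v x \<le> residue_mass p I w (int N) (h x mod int N)"
        by (intro subset_sum_mass_le_residue_mass fin p h)
      also have "\<dots> \<le> (\<Sum>k\<in>{0..<int N}. norm (zn_fourier (int N) (residue_mass p I w (int N)) k)) / of_int (int N)"
        using N0 by (intro zn_le_mean_fourier) auto
      also have "\<dots> \<le> X N" using mean[OF N] \<open>a = 1\<close> by simp
      finally show "subset_sum_mass p I v x \<le> X N" .
    qed
  }
  {
    assume a1: "a > 1"
    have "(\<lambda>n. X n powr (1 / (a - 1))) \<longlonglongrightarrow> L powr (1 / (a - 1))"
    proof (rule tendsto_powr'[OF X tendsto_const])
      show "L \<noteq> 0 \<or> 0 < 1 / (a - 1) \<and> (\<forall>\<^sub>F n in sequentially. 0 \<le> X n)"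
        using a1 by (auto simp: X_def intro!: always_eventually sum_nonneg divide_nonneg_nonneg)
    qed
    then show "(\<Sum>x\<in>(\<lambda>J. \<Sum>i\<in>J. v i) ` Pow I. subset_sum_mass p I v x powr (a / (a - 1))) \<le> L powr (1 / (a - 1))"
    proof (rule le_limit_along_primes)
      fix N assume N: "prime N" "N > n0"
      then have N0: "int N > 0" using prime_gt_0_nat by simp
      have "(\<Sum>x\<in>(\<lambda>J. \<Sum>i\<in>J. v i) ` Pow I. subset_sum_mass p I v x powr (a / (a - 1)))
        \<le> (\<Sum>r\<in>{0..<int N}. residue_mass p I w (int N) r powr (a / (a - 1)))"
        using a1 by (intro sum_subset_sum_mass_powr_le[OF fin N0 p h]) auto
      also have "\<dots> \<le> ((\<Sum>k\<in>{0..<int N}. norm (zn_fourier (int N) (residue_mass p I w (int N)) k) powr a) / of_int (int N)) powr (1 / (a - 1))"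
        using a a1 by (intro zn_hausdorff_young[OF N0] residue_mass_nonneg p) auto
      also have "\<dots> \<le> X N powr (1 / (a - 1))"
        using a1 mean[OF N] by (intro powr_mono2) (auto intro!: sum_nonneg divide_nonneg_nonneg)
      finally show "(\<Sum>x\<in>(\<lambda>J. \<Sum>i\<in>J. v i) ` Pow I. subset_sum_mass p I v x powr (a / (a - 1))) \<le> X N powr (1 / (a - 1))" .
    qed
  }
qed

section \<open>Entropy of weighted Bernoulli sums\<close>

lemma variance_bernoulli_rv:
  assumes "prob_space M" and X: "bernoulli_rv M X p"
  shows "prob_space.variance M X = p * (1 - p)"
proof -
  interpret prob_space M by fact
  have meas [measurable]: "X \<in> borel_measurable M" and p: "prob {\<omega> \<in> space M. X \<omega> = 1} = p"
    and AE01: "AE \<omega> in M. X \<omega> \<in> {0, 1}"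
    using X by (auto simp: bernoulli_rv_def)
  let ?E = "{\<omega> \<in> space M. X \<omega> = 1}"
  have E: "?E \<in> events" by measurable
  have "AE \<omega> in M. (X \<omega>)\<^sup>2 = X \<omega>" and XE: "AE \<omega> in M. X \<omega> = indicator ?E \<omega>"
    using AE01 AE_space by (eventually_elim, auto simp: indicator_def)+
  then have X2: "expectation (\<lambda>\<omega>. (X \<omega>)\<^sup>2) = expectation X"
    by (intro integral_cong_AE) auto
  have "expectation X = expectation (indicator ?E)"
    using XE E by (intro integral_cong_AE) auto
  then have EX: "expectation X = p" using E p by simp
  have bdd: "AE \<omega> in M. norm (X \<omega>) \<le> 1" "AE \<omega> in M. norm ((X \<omega>)\<^sup>2) \<le> 1"
    using AE01 by (eventually_elim, auto)+
  have "integrable M X" "integrable M (\<lambda>\<omega>. (X \<omega>)\<^sup>2)"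
    by (rule integrable_const_bound[OF bdd(1)], simp, rule integrable_const_bound[OF bdd(2)], simp)
  then have "variance X = expectation (\<lambda>\<omega>. (X \<omega>)\<^sup>2) - (expectation X)\<^sup>2" by (rule variance_eq)
  also have "\<dots> = p * (1 - p)" unfolding X2 EX by (simp add: power2_eq_square algebra_simps)
  finally show ?thesis .
qed

text \<open>Almost every outcome lies in exactly one event \<open>D J\<close> with \<open>J\<close>
  inside \<open>I\<close>, where \<open>B\<close> is the indicator of \<open>J\<close>. Independence
  gives this event the probability \<open>subset_weight p I J\<close>.\<close>

lemma point_mass_weighted_bernoulli_sum:
  assumes "prob_space M" and I: "finite I" "I \<noteq> {}"
    and B: "\<And>i. i \<in> I \<Longrightarrow> bernoulli_rv M (B i) (p i)"
    and indep: "prob_space.indep_vars M (\<lambda>_. borel) B I"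
  shows "point_mass M (\<lambda>\<omega>. \<Sum>i\<in>I. v i * B i \<omega>) x = subset_sum_mass p I v x"
proof -
  interpret prob_space M by fact
  have meas [measurable]: "\<And>i. i \<in> I \<Longrightarrow> B i \<in> borel_measurable M"
    and P1: "\<And>i. i \<in> I \<Longrightarrow> prob {\<omega> \<in> space M. B i \<omega> = 1} = p i"
    and P0: "\<And>i. i \<in> I \<Longrightarrow> prob {\<omega> \<in> space M. B i \<omega> = 0} = 1 - p i"
    and AE01: "\<And>i. i \<in> I \<Longrightarrow> AE \<omega> in M. B i \<omega> \<in> {0, 1}"
    using B by (auto simp: bernoulli_rv_def)
  define D where "D J = (\<Inter>i\<in>I. B i -` {of_bool (i \<in> J)} \<inter> space M)" for J
  have mem_D: "\<omega> \<in> D J \<longleftrightarrow> \<omega> \<in> space M \<and> (\<forall>i\<in>I. B i \<omega> = of_bool (i \<in> J))" for J \<omega>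
    using I by (auto simp: D_def)
  have D_events: "D J \<in> events" for J
    unfolding D_def using I meas by (intro sets.finite_INT measurable_sets[of _ _ borel]) auto
  have prob_D: "prob (D J) = subset_weight p I J" if J: "J \<in> Pow I" for J
  proof -
    have "prob (D J) = (\<Prod>i\<in>I. prob (B i -` {of_bool (i \<in> J)} \<inter> space M))"
      unfolding D_def using I by (intro indep_varsD_finite[OF indep]) auto
    also have "\<dots> = (\<Prod>i\<in>I. if i \<in> J then p i else 1 - p i)"
    proof (rule prod.cong[OF refl])
      fix i assume "i \<in> I"
      moreover have "B i -` {c} \<inter> space M = {\<omega> \<in> space M. B i \<omega> = c}" for c by auto
      ultimately show "prob (B i -` {of_bool (i \<in> J)} \<inter> space M) = (if i \<in> J then p i else 1 - p i)"
        using P0 P1 by simp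
    qed
    also have "\<dots> = subset_weight p I J"
      using I J by (simp add: prod.If_cases subset_weight_def Int_absorb1 Diff_eq)
    finally show ?thesis .
  qed
  let ?\<J> = "{J \<in> Pow I. (\<Sum>i\<in>J. v i) = x}"
  have sum_D: "(\<Sum>i\<in>I. v i * B i \<omega>) = (\<Sum>i\<in>J. v i)" if "\<omega> \<in> D J" "J \<subseteq> I" for \<omega> J
  proof -
    have "(\<Sum>i\<in>I. v i * B i \<omega>) = (\<Sum>i\<in>I. if i \<in> J then v i else 0)"
      using that by (intro sum.cong) (auto simp: mem_D)
    then show ?thesis using I that by (simp add: sum.If_cases Int_absorb1)
  qed
  have "prob {\<omega> \<in> space M. (\<Sum>i\<in>I. v i * B i \<omega>) = x} = prob (\<Union>J\<in>?\<J>. D J)"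
  proof (rule finite_measure_eq_AE)
    have "AE \<omega> in M. \<forall>i\<in>I. B i \<omega> \<in> {0, 1}" using AE01 I by (simp add: AE_finite_all)
    then show "AE \<omega> in M. \<omega> \<in> {\<omega> \<in> space M. (\<Sum>i\<in>I. v i * B i \<omega>) = x} \<longleftrightarrow> \<omega> \<in> (\<Union>J\<in>?\<J>. D J)"
      using AE_space
    proof eventually_elim
      case (elim \<omega>)
      define K where "K = {i \<in> I. B i \<omega> = 1}"
      have K: "\<omega> \<in> D K" "K \<subseteq> I" using elim by (auto simp: mem_D K_def)
      show ?case
      proof
        assume "\<omega> \<in> {\<omega> \<in> space M. (\<Sum>i\<in>I. v i * B i \<omega>) = x}"
        then have "K \<in> ?\<J>" using sum_D[OF K] K by simp
        then show "\<omega> \<in> (\<Union>J\<in>?\<J>. D J)" using K by blast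
      next
        assume "\<omega> \<in> (\<Union>J\<in>?\<J>. D J)"
        then show "\<omega> \<in> {\<omega> \<in> space M. (\<Sum>i\<in>I. v i * B i \<omega>) = x}" using sum_D elim by auto
      qed
    qed
    show "{\<omega> \<in> space M. (\<Sum>i\<in>I. v i * B i \<omega>) = x} \<in> events" by measurable
    show "(\<Union>J\<in>?\<J>. D J) \<in> events" using I D_events by (intro sets.finite_UN) auto
  qed
  also have "\<dots> = (\<Sum>J\<in>?\<J>. prob (D J))"
  proof (rule finite_measure_finite_Union)
    show "finite ?\<J>" using I by simp
    show "D ` ?\<J> \<subseteq> events" using D_events by auto
    show "disjoint_family_on D ?\<J>"
      unfolding disjoint_family_on_def
    proof (intro ballI impI)
      fix J K assume JK: "J \<in> ?\<J>" "K \<in> ?\<J>" "J \<noteq> K"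
      show "D J \<inter> D K = {}"
      proof (rule ccontr)
        assume "D J \<inter> D K \<noteq> {}"
        then obtain \<omega> where "\<omega> \<in> D J" "\<omega> \<in> D K" by blast
        then have "i \<in> J \<longleftrightarrow> i \<in> K" if "i \<in> I" for i
          using that by (auto simp: mem_D of_bool_def split: if_splits)
        then show False using JK by auto
      qed
    qed
  qed
  also have "\<dots> = subset_sum_mass p I v x"
    unfolding subset_sum_mass_def by (rule sum.cong[OF refl]) (auto intro: prob_D)
  finally show ?thesis by (simp add: point_mass_def)
qed

text \<open>One positive mass places the supremum where \<open>ln\<close> is increasing; the uniform
  bound makes the supremum meaningful.\<close>

lemma renyi_entropy_infinity_ge:
  assumes "\<And>x. point_mass M S x \<le> c" "point_mass M S y > 0"
  shows "renyi_entropy \<infinity> M S \<ge> - ln c"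
proof -
  have bdd: "bdd_above (range (point_mass M S))" by (rule bdd_aboveI2[OF assms(1)])
  have "0 < (SUP x. point_mass M S x)"
    using assms(2) cSUP_upper[OF UNIV_I bdd, of y] by (rule less_le_trans)
  moreover have "(SUP x. point_mass M S x) \<le> c" using assms(1) by (intro cSUP_least) auto
  ultimately show ?thesis by (simp add: renyi_entropy_def)
qed

text \<open>The exponent \<open>\<alpha> - 1\<close> cancels against the prefactor of the entropy.
  Positivity of one mass allows taking logarithms monotonically.\<close>

lemma renyi_entropy_real_ge:
  fixes \<alpha> :: real
  assumes V: "finite V" "\<And>x. x \<notin> V \<Longrightarrow> point_mass M S x = 0"
    and \<alpha>: "\<alpha> > 1" and c: "c > 0"
    and le: "(\<Sum>x\<in>V. point_mass M S x powr \<alpha>) \<le> c powr (\<alpha> - 1)"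
    and y: "point_mass M S y > 0"
  shows "renyi_entropy (ereal \<alpha>) M S \<ge> - ln c"
proof -
  have sum_eq: "(\<Sum>\<^sub>\<infinity>x. point_mass M S x powr \<alpha>) = (\<Sum>x\<in>V. point_mass M S x powr \<alpha>)"
    using V by (subst infsum_cong_neutral[of V UNIV _ "\<lambda>x. point_mass M S x powr \<alpha>"]) auto
  have "y \<in> V" using V y by force
  then have "0 < (\<Sum>x\<in>V. point_mass M S x powr \<alpha>)"
    using V y by (intro sum_pos2[of V y]) auto
  then have "ln (\<Sum>x\<in>V. point_mass M S x powr \<alpha>) \<le> ln (c powr (\<alpha> - 1))"
    using le by (subst ln_le_cancel_iff) auto
  also have "\<dots> = (\<alpha> - 1) * ln c" using c by (simp add: ln_powr)
  finally show ?thesis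
    using \<alpha> by (simp add: renyi_entropy_def sum_eq field_simps)
qed

theorem theorem5p2:
  fixes M :: "'a measure"
    and n :: nat
    and v p \<sigma>i :: "nat \<Rightarrow> real"
    and B :: "nat \<Rightarrow> 'a \<Rightarrow> real"
    and \<sigma> :: real
    and S :: "'a \<Rightarrow> real"
    and \<alpha> :: ereal
  assumes "prob_space M"
    and "n \<ge> 1"
    and "\<And>i. i \<in> {1..n} \<Longrightarrow> v i \<noteq> 0"
    and "\<And>i. i \<in> {1..n} \<Longrightarrow> bernoulli_rv M (B i) (p i)"
    and "prob_space.indep_vars M (\<lambda>_. borel) B {1..n}"
    and "\<And>i. i \<in> {1..n} \<Longrightarrow> prob_space.variance M (B i) = (\<sigma>i i)\<^sup>2"
    and "S = (\<lambda>\<omega>. \<Sum>i = 1..n. v i * B i \<omega>)"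
    and "\<sigma>\<^sup>2 = (\<Sum>i = 1..n. (\<sigma>i i)\<^sup>2)"
    and "\<sigma>\<^sup>2 > 0"
    and "2 \<le> \<alpha>"
  shows "let \<alpha>' = conjugate_exponent \<alpha>;
             R = sqrt (6 * \<sigma>\<^sup>2 * \<alpha>');
             L = ln (R / integral {0..R} (\<lambda>t. exp (- (t\<^sup>2 / 2))))
         in renyi_entropy \<alpha> M S \<ge> L \<and>
            L \<ge> 1 / 2 * max (ln (1 + 2 * \<alpha>' * \<sigma>\<^sup>2)) (ln (12 * \<alpha>' * \<sigma>\<^sup>2 / pi))"
proof -
  define a where "a = conjugate_exponent \<alpha>"
  define R where "R = sqrt (6 * \<sigma>\<^sup>2 * a)"
  define G where "G = integral {0..R} (\<lambda>t. exp (- (t\<^sup>2 / 2)))"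
  define V where "V = (\<lambda>J. \<Sum>i\<in>J. v i) ` Pow {1..n}"
  have p: "p i \<in> {0..1}" if "i \<in> {1..n}" for i
    using assms(4)[OF that] by (simp add: bernoulli_rv_def)
  have s: "\<sigma>\<^sup>2 = (\<Sum>i\<in>{1..n}. p i * (1 - p i))"
    using assms(6) variance_bernoulli_rv[OF assms(1,4)] unfolding assms(8) by (intro sum.cong) auto
  have mass: "point_mass M S x = subset_sum_mass p {1..n} v x" for x
    unfolding assms(7) using assms(2) by (intro point_mass_weighted_bernoulli_sum assms) auto
  \<comment> \<open>Conjugation is an involution: it maps orders from 2 to infinity to exponents
    from 2 down to 1.\<close>
  have a: "1 \<le> a" "a \<le> 2" and \<alpha>_cases: "(\<alpha> = \<infinity> \<and> a = 1) \<or> (a > 1 \<and> \<alpha> = ereal (a / (a - 1)))"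
    using assms(10) by (cases \<alpha>; simp add: a_def conjugate_exponent_def field_simps)+
  have R: "R > 0" "R\<^sup>2 = 6 * \<sigma>\<^sup>2 * a" using a assms(9) by (auto simp: R_def)
  have "integral {0..1} (\<lambda>u. exp (- (a * \<sigma>\<^sup>2) * (1 - cos (2 * pi * u))))
    \<le> integral {0..1} (\<lambda>u. exp (- (a * \<sigma>\<^sup>2) * (3 * u\<^sup>2)))"
    unfolding integral_exp_cos_double using a by (intro integral_exp_cos_le_gauss) auto
  \<comment> \<open>The constant 6 in \<open>R\<close> is twice the 3 of the convex comparison,
    which makes the exponent \<open>(R u)^2 / 2\<close>.\<close>
  also have "(\<lambda>u. exp (- (a * \<sigma>\<^sup>2) * (3 * u\<^sup>2))) = (\<lambda>u. exp (- ((R * u)\<^sup>2 / 2)))"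
    by (simp add: power_mult_distrib R mult_ac)
  also have "integral {0..1} \<dots> = G / R"
    unfolding G_def using R(1) by (rule integral_gauss_scale)
  finally have circle: "integral {0..1} (\<lambda>u. exp (- (a * \<sigma>\<^sup>2) * (1 - cos (2 * pi * u)))) \<le> G / R" .
  \<comment> \<open>The masses on the finite set \<open>V\<close> sum to 1, so one of them is
    positive.\<close>
  obtain y where y: "point_mass M S y > 0"
  proof -
    have "(\<Sum>x\<in>V. subset_sum_mass p {1..n} v x) = 1"
      using sum.group[of "Pow {1..n}" V "\<lambda>J. \<Sum>i\<in>J. v i" "subset_weight p {1..n}"]
      by (simp add: V_def subset_sum_mass_def sum_subset_weight)
    then have "\<exists>x\<in>V. 0 < subset_sum_mass p {1..n} v x"
      by (metis not_less sum_nonpos zero_less_one)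
    then show ?thesis using that by (auto simp: mass)
  qed
  have zero: "point_mass M S x = 0" if "x \<notin> V" for x
  proof -
    have "{J \<in> Pow {1..n}. (\<Sum>i\<in>J. v i) = x} = {}" using that by (auto simp: V_def)
    then show ?thesis by (simp only: mass subset_sum_mass_def sum.empty)
  qed
  have G: "G > 0"
  proof -
    have "integral {0..R} (\<lambda>t. exp (- (R\<^sup>2 / 2))) \<le> G"
      unfolding G_def using R(1)
      by (intro integral_le integrable_continuous_real continuous_intros) (auto intro: power_mono)
    moreover have "0 < integral {0..R} (\<lambda>t. exp (- (R\<^sup>2 / 2)))" using R(1) by simp
    ultimately show ?thesis by linarith
  qed
  have ln_eq: "ln (R / G) = - ln (G / R)" using R(1) G by (simp add: ln_div)
  have "renyi_entropy \<alpha> M S \<ge> ln (R / G)"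
    using \<alpha>_cases
  proof
    assume *: "\<alpha> = \<infinity> \<and> a = 1"
    have "point_mass M S x \<le> G / R" for x
    proof (rule order_trans[OF _ circle])
      show "point_mass M S x \<le> integral {0..1} (\<lambda>u. exp (- (a * \<sigma>\<^sup>2) * (1 - cos (2 * pi * u))))"
        unfolding mass using a p assms(3) s assms(9) * by (intro subset_sum_mass_bounds(1)) auto
    qed
    then show ?thesis unfolding ln_eq using * renyi_entropy_infinity_ge[OF _ y] by blast
  next
    assume *: "a > 1 \<and> \<alpha> = ereal (a / (a - 1))"
    then have exps: "a / (a - 1) - 1 = 1 / (a - 1)" "a / (a - 1) > 1" by (auto simp: field_simps)
    have "(\<Sum>x\<in>V. point_mass M S x powr (a / (a - 1)))
      \<le> integral {0..1} (\<lambda>u. exp (- (a * \<sigma>\<^sup>2) * (1 - cos (2 * pi * u)))) powr (1 / (a - 1))"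
      unfolding mass V_def using a p assms(3) s assms(9) * by (intro subset_sum_mass_bounds(2)) auto
    also have "\<dots> \<le> (G / R) powr (1 / (a - 1))"
      using * circle by (intro powr_mono2 integral_nonneg integrable_continuous_real continuous_intros) auto
    finally have "renyi_entropy (ereal (a / (a - 1))) M S \<ge> - ln (G / R)"
      using G R(1) exps zero by (intro renyi_entropy_real_ge[OF _ _ _ _ _ y, of V]) (auto simp: V_def)
    then show ?thesis using * ln_eq by simp
  qed
  moreover have "1 / 2 * max (ln (1 + 2 * a * \<sigma>\<^sup>2)) (ln (12 * a * \<sigma>\<^sup>2 / pi)) \<le> ln (R / G)"
  proof -
    \<comment> \<open>Both lower bounds reduce to estimates \<open>G <= R / sqrt x\<close>. The
      first takes \<open>x = 1 + R^2 / 3\<close>; the second takes the \<open>x\<close> for which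
      \<open>R / sqrt x\<close> is the half-line integral \<open>sqrt (pi / 2)\<close>.\<close>
    have half_ln: "1 / 2 * ln x \<le> ln (R / G)" if "x > 0" "G \<le> R / sqrt x" for x
    proof -
      have "sqrt x \<le> R / G" using that G by (simp add: field_simps)
      then have "ln (sqrt x) \<le> ln (R / G)" using that G R(1) by (subst ln_le_cancel_iff) auto
      then show ?thesis using that by (simp add: ln_sqrt)
    qed
    have pos: "a * \<sigma>\<^sup>2 > 0" using a assms(9) by simp
    have "G \<le> R / sqrt (1 + 2 * a * \<sigma>\<^sup>2)"
      using integral_gauss_le_sqrt[of R] R by (simp add: G_def mult_ac)
    moreover have "R / sqrt (12 * a * \<sigma>\<^sup>2 / pi) = sqrt (pi / 2)"
    proof -
      have "R / sqrt (12 * a * \<sigma>\<^sup>2 / pi) = sqrt (6 * \<sigma>\<^sup>2 * a / (12 * a * \<sigma>\<^sup>2 / pi))"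
        by (simp only: R_def real_sqrt_divide)
      also have "6 * \<sigma>\<^sup>2 * a / (12 * a * \<sigma>\<^sup>2 / pi) = pi / 2"
        using a assms(9) by (auto simp: field_simps)
      finally show ?thesis .
    qed
    then have "G \<le> R / sqrt (12 * a * \<sigma>\<^sup>2 / pi)" using integral_gauss_le_pi by (simp add: G_def)
    ultimately show ?thesis
      using half_ln[of "1 + 2 * a * \<sigma>\<^sup>2"] half_ln[of "12 * a * \<sigma>\<^sup>2 / pi"] pos
      by (auto simp: max_def)
  qed
  ultimately show ?thesis by (simp add: Let_def a_def R_def G_def)
qed

end
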